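(* There is an absolute constant $C>0$ such that the following holds. Let $s\ge 1$ be an integer, and let $A,\Phi\in\mathbb{C}^{m\times d}$ be such that the restricted isometry constant $\delta_{4s}$ of $A$ satisfies $$\delta_{4s}\le \frac{1.1}{\left(1+\varepsilon_A^{(4s)}\right)^2}-1,\qquad \varepsilon_A^{(4s)}=\frac{\|A-\Phi\|_2^{(4s)}}{\|A\|_2^{(4s)}}.$$ Let $x\in\mathbb{C}^d$, $x\neq 0$, be an arbitrary signal with measurements $b=Ax$, corrupted with noise $e\in\mathbb{C}^m$ to form $y=Ax+e$. Suppose that $$\alpha_s+\beta_s\le \frac{1}{2\,\kappa_A^{(s)}},$$ where $$\alpha_s=\frac{\|x-x_s\|_2}{\|x_s\|_2},\qquad \beta_s=\frac{\|x-x_s\|_1}{\sqrt{s}\,\|x_s\|_2},\qquad \kappa_A^{(s)}=\frac{\sqrt{1+\delta_s}}{\sqrt{1-\delta_s}},$$ and $\delta_s$ is the restricted isometry constant of $A$ of order $s$. Let $x^\sharp$ be the reconstruction produced by CoSaMP (run for sufficiently many iterations) using the decoding matrix $\Phi$ (instead of $A$), the measurements $y$ and the sparsity level $s$. Then $$\|x^\sharp-x\|_2\le C\left(\|x-x_s\|_2+\frac{1}{\sqrt{s}}\|x-x_s\|_1+\left(\varepsilon\,\alpha_s+\varepsilon^{(s)}\right)\|b\|_2+\|e\|_2\right),$$ where $\varepsilon=\|A-\Phi\|_2$ and $\varepsilon^{(s)}=\|A-\Phi\|_2^{(s)}$.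
   Context: Notation. For a vector, $\|\cdot\|_1$ and $\|\cdot\|_2$ are the $\ell_1$ and Euclidean norms; for a matrix, $\|\cdot\|_2$ is the spectral norm, and $\|M\|_2^{(s)}$ is the largest spectral norm over all $s$-column submatrices of $M$. A vector is $s$-sparse if it has at most $s$ non-zero components; $\mathrm{supp}(z)$ is the set of indices of non-zero components of $z$. For a vector $z$ and integer $r$, $z_r$ denotes the vector consisting of the $r$ largest components of $z$ in magnitude (other components set to zero). $w|_T$ is the restriction of the vector $w$ to the indices in $T$, and $M_T$ is the matrix $M$ restricted to the columns indexed by $T$. $M^*$ is the conjugate transpose and $M^\dagger$ the pseudoinverse. Restricted isometry constant. A matrix $A$ satisfies the restricted isometry property with parameters $(s,\delta)$ if $(1-\delta)\|z\|_2^2\le\|Az\|_2^2\le(1+\delta)\|z\|_2^2$ for every $s$-sparse vector $z$. The restricted isometry constant (RIC) $\delta_s$ of $A$ is the smallest such $\delta$. CoSaMP with decoding matrix $\Phi$, measurement vector $y$, sparsity level $s$: set $a^0=0$, $v=y$, $k=0$. Then repeat the following steps, incrementing $k$ at each iteration (so the first iteration has $k=1$), until halting: (1) Signal proxy: $u=\Phi^*v$, $\Omega=\mathrm{supp}(u_{2s})$, $T=\Omega\cup\mathrm{supp}(a^{k-1})$. (2) Signal estimation (least squares): $w|_T=\Phi_T^\dagger y$, $w|_{T^c}=0$. (3) Prune: $a^k=w_s$. (4) Sample update: $v=y-\Phi a^k$. The output (reconstruction) is the $s$-sparse vector $a^k$ at the final iteration. "Run for sufficiently many iterations" means that there is a $K$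 (which may depend on all the data) such that the stated bound holds for $x^\sharp=a^k$ for every $k\ge K$. *)

theory Defs
  imports
    "HOL-Analysis.L2_Norm"
    "Jordan_Normal_Form.Schur_Decomposition"
    "Jordan_Normal_Form.DL_Submatrix"
begin

(* Vectors and matrices are those of Jordan_Normal_Form, whose dimensions are natural numbers
   rather than types, so that an absolute constant can be quantified before the dimensions. *)

definition l1_norm :: "complex vec \<Rightarrow> real" where
  "l1_norm v = (\<Sum>i<dim_vec v. cmod (v $ i))"

definition l2_norm :: "complex vec \<Rightarrow> real" where
  "l2_norm v = L2_set (\<lambda>i. cmod (v $ i)) {..<dim_vec v}"

definition spectral_norm :: "complex mat \<Rightarrow> real" where
  "spectral_norm M = (SUP z \<in> {z \<in> carrier_vec (dim_col M). l2_norm z \<le> 1}. l2_norm (M *\<^sub>v z))"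

definition col_submatrix :: "complex mat \<Rightarrow> nat set \<Rightarrow> complex mat" where
  "col_submatrix M T = submatrix M UNIV T"

(* The minimum only matters when n exceeds the number of columns; the only submatrix to consider
   is then M itself, just as every vector is then n-sparse. *)
definition spectral_norm_cols :: "nat \<Rightarrow> complex mat \<Rightarrow> real" where
  "spectral_norm_cols n M =
     Max ((\<lambda>T. spectral_norm (col_submatrix M T)) `
       {T. T \<subseteq> {..<dim_col M} \<and> card T = min n (dim_col M)})"

definition supp :: "complex vec \<Rightarrow> nat set" where
  "supp z = {i. i < dim_vec z \<and> z $ i \<noteq> 0}"

definition sparse :: "nat \<Rightarrow> complex vec \<Rightarrow> bool" where
  "sparse n z \<longleftrightarrow> card (supp z) \<le> n"

(* z' is a vector z_r of the r largest components of z in magnitude. It is a relation because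
   ties may be broken in any way. *)
definition largest_part :: "nat \<Rightarrow> complex vec \<Rightarrow> complex vec \<Rightarrow> bool" where
  "largest_part r z z' \<longleftrightarrow>
     (\<exists>S \<subseteq> {..<dim_vec z}. card S = min r (dim_vec z) \<and>
        (\<forall>i \<in> S. \<forall>j \<in> {..<dim_vec z} - S. cmod (z $ j) \<le> cmod (z $ i)) \<and>
        z' = vec (dim_vec z) (\<lambda>i. if i \<in> S then z $ i else 0))"

definition rip :: "complex mat \<Rightarrow> nat \<Rightarrow> real \<Rightarrow> bool" where
  "rip A n \<delta> \<longleftrightarrow>
     (\<forall>z \<in> carrier_vec (dim_col A). sparse n z \<longrightarrow>
        (1 - \<delta>) * (l2_norm z)\<^sup>2 \<le> (l2_norm (A *\<^sub>v z))\<^sup>2 \<and>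
        (l2_norm (A *\<^sub>v z))\<^sup>2 \<le> (1 + \<delta>) * (l2_norm z)\<^sup>2)"

definition ric :: "complex mat \<Rightarrow> nat \<Rightarrow> real" where
  "ric A n = (LEAST \<delta>. rip A n \<delta>)"

(* The Moore-Penrose pseudoinverse, by the four Penrose equations. *)
definition pseudoinverse :: "complex mat \<Rightarrow> complex mat" where
  "pseudoinverse M =
     (THE X. X \<in> carrier_mat (dim_col M) (dim_row M) \<and>
        M * X * M = M \<and> X * M * X = X \<and>
        mat_adjoint (M * X) = M * X \<and> mat_adjoint (X * M) = X * M)"

(* The entries are listed in increasing order of index, as the columns of col_submatrix are. *)
definition vec_restrict :: "complex vec \<Rightarrow> nat set \<Rightarrow> complex vec" where
  "vec_restrict w T = vec (card {i. i < dim_vec w \<and> i \<in> T}) (\<lambda>j. w $ pick T j)"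

definition cosamp_step ::
  "complex mat \<Rightarrow> complex vec \<Rightarrow> nat \<Rightarrow> complex vec \<Rightarrow> complex vec \<Rightarrow> complex vec \<Rightarrow> complex vec \<Rightarrow> bool"
where
  "cosamp_step \<Phi> y s a v a' v' \<longleftrightarrow>
     (\<exists>p w T.
        largest_part (2 * s) (mat_adjoint \<Phi> *\<^sub>v v) p \<and>
        T = supp p \<union> supp a \<and>
        w \<in> carrier_vec (dim_col \<Phi>) \<and>
        vec_restrict w T = pseudoinverse (col_submatrix \<Phi> T) *\<^sub>v y \<and>
        (\<forall>i < dim_col \<Phi>. i \<notin> T \<longrightarrow> w $ i = 0) \<and>
        largest_part s w a' \<and>
        v' = y - \<Phi> *\<^sub>v a')"

(* a is a sequence of CoSaMP iterates (without halting), for some way of breaking the ties. *)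
definition cosamp_run ::
  "complex mat \<Rightarrow> complex vec \<Rightarrow> nat \<Rightarrow> (nat \<Rightarrow> complex vec) \<Rightarrow> bool"
where
  "cosamp_run \<Phi> y s a \<longleftrightarrow>
     (\<exists>v. a 0 = 0\<^sub>v (dim_col \<Phi>) \<and> v 0 = y \<and>
        (\<forall>k. cosamp_step \<Phi> y s (a k) (v k) (a (Suc k)) (v (Suc k))))"

definition rel_perturbation :: "complex mat \<Rightarrow> complex mat \<Rightarrow> nat \<Rightarrow> real" where
  "rel_perturbation A \<Phi> n = spectral_norm_cols n (A - \<Phi>) / spectral_norm_cols n A"

definition kappa :: "complex mat \<Rightarrow> nat \<Rightarrow> real" where
  "kappa A s = sqrt (1 + ric A s) / sqrt (1 - ric A s)"

(* In the next two, xs stands for x_s. *)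
definition alpha_ratio :: "complex vec \<Rightarrow> complex vec \<Rightarrow> real" where
  "alpha_ratio x xs = l2_norm (x - xs) / l2_norm xs"

definition beta_ratio :: "nat \<Rightarrow> complex vec \<Rightarrow> complex vec \<Rightarrow> real" where
  "beta_ratio s x xs = l1_norm (x - xs) / (sqrt (real s) * l2_norm xs)"

end

(* The bound on delta_4s forces the decoding matrix Phi to be a near isometry (constant 1/10) on
   4s-sparse vectors. Relative to Phi and the sparse signal x_s, the measurements carry the noise
   e' = (A - Phi) x + Phi (x - x_s) + e, and each CoSaMP iteration at least halves the error up to
   7 ||e'||; the compressibility condition bounds ||x_s||, hence the term (A - Phi) x, by a
   multiple of ||b||. If the right-hand side vanishes, geometric convergence is not enough: the
   iterates then eventually contain the support of x_s, after which least squares is exact. *)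
theory Submission
  imports Defs
begin


section \<open>Norms and the real inner product\<close>

text \<open>The order 4s comes from adding supports: a residual \<open>x - a\<close> and the
  selected proxy have at most 2s indices each, and the least squares set has at most 3s, to which
  the sparse target adds s. One iteration loses a factor \<open>2 * \<delta>\<close> in
  identification, \<open>1 / (1 - \<delta>)\<close> in estimation and 2 in pruning; at
  \<open>\<delta> = 1 / 10\<close> the product is 4/9, which is where the rate 1/2 comes from. Two
  notions given by description must first be shown to denote something. The least isometry constant
  exists because the infimum is attained, and the pseudoinverse is unique for independent columns;
  of the latter only the normal equations are kept. Ties in the selection are harmless, since only
  domination of the discarded entries by the kept ones is ever used. Column submatrices occur where
  the definitions demand them; all estimates concern vectors of full length with prescribed
  support.\<close>

lemma l2_norm_sq: "(l2_norm v)\<^sup>2 = (\<Sum>i<dim_vec v. (cmod (v $ i))\<^sup>2)"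
  by (simp add: l2_norm_def L2_set_def sum_nonneg)

lemma l2_norm_nonneg [simp]: "0 \<le> l2_norm v"
  by (simp add: l2_norm_def)

lemma l2_norm_zero [simp]: "l2_norm (0\<^sub>v n) = 0"
  by (auto simp: l2_norm_def L2_set_eq_0_iff)

lemma l1_norm_nonneg [simp]: "0 \<le> l1_norm v"
  by (simp add: l1_norm_def sum_nonneg)

lemma l2_norm_triangle:
  assumes "u \<in> carrier_vec n" "v \<in> carrier_vec n"
  shows "l2_norm (u + v) \<le> l2_norm u + l2_norm v"
proof -
  have "l2_norm (u + v) = L2_set (\<lambda>i. cmod (u $ i + v $ i)) {..<n}"
    using assms by (auto simp: l2_norm_def intro!: L2_set_cong)
  also have "\<dots> \<le> L2_set (\<lambda>i. cmod (u $ i) + cmod (v $ i)) {..<n}"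
    by (intro L2_set_mono) (auto intro: norm_triangle_ineq)
  also have "\<dots> \<le> l2_norm u + l2_norm v"
    using assms L2_set_triangle_ineq[of "\<lambda>i. cmod (u $ i)" "\<lambda>i. cmod (v $ i)" "{..<n}"]
    by (simp add: l2_norm_def)
  finally show ?thesis .
qed

lemma l2_norm_uminus [simp]: "l2_norm (- v) = l2_norm v"
  by (auto simp: l2_norm_def intro!: L2_set_cong)

lemma l2_norm_minus_commute:
  assumes "u \<in> carrier_vec n" "v \<in> carrier_vec n"
  shows "l2_norm (u - v) = l2_norm (v - u)"
  using assms by (auto simp: l2_norm_def norm_minus_commute intro!: L2_set_cong)

lemma l2_norm_diff_triangle:
  assumes "u \<in> carrier_vec n" "v \<in> carrier_vec n"
  shows "l2_norm (u - v) \<le> l2_norm u + l2_norm v"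
proof -
  have "u - v = u + - v"
    using assms by auto
  then show ?thesis
    using l2_norm_triangle[of u n "- v"] assms by simp
qed

lemma l2_norm_triangle_mid:
  assumes "u \<in> carrier_vec n" "v \<in> carrier_vec n" "w \<in> carrier_vec n"
  shows "l2_norm (u - w) \<le> l2_norm (u - v) + l2_norm (v - w)"
proof -
  have "u - w = (u - v) + (v - w)"
    using assms by auto
  then show ?thesis
    using l2_norm_triangle[of "u - v" n "v - w"] assms by simp
qed

lemma l2_norm_smult: "l2_norm (c \<cdot>\<^sub>v v) = cmod c * l2_norm v"
  by (auto simp: l2_norm_def norm_mult L2_set_right_distrib intro!: L2_set_cong)

lemma l2_norm_eq_0_iff:
  assumes "v \<in> carrier_vec n"
  shows "l2_norm v = 0 \<longleftrightarrow> v = 0\<^sub>v n"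
  using assms by (auto simp: l2_norm_def L2_set_eq_0_iff)

lemma cmod_le_l2_norm:
  assumes "i < dim_vec v"
  shows "cmod (v $ i) \<le> l2_norm v"
  unfolding l2_norm_def using assms by (intro member_le_L2_set) auto

text \<open>The real part of the Hermitian inner product: the squared norm of a real combination of
  two vectors involves nothing else, so polarization over the reals suffices.\<close>

definition re_inner :: "complex vec \<Rightarrow> complex vec \<Rightarrow> real" where
  "re_inner u v = (\<Sum>i<dim_vec u. Re (u $ i * cnj (v $ i)))"

lemma re_inner_self: "re_inner u u = (l2_norm u)\<^sup>2"
  unfolding re_inner_def l2_norm_sq by (simp add: cmod_power2 flip: power2_eq_square)

lemma re_inner_diff_left:
  assumes "u \<in> carrier_vec n" "v \<in> carrier_vec n"
  shows "re_inner (u - v) w = re_inner u w - re_inner v w"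
  using assms by (simp add: re_inner_def algebra_simps sum_subtractf sum.distrib)

lemma l2_norm_lincomb_sq:
  fixes t :: real
  assumes "u \<in> carrier_vec n" "v \<in> carrier_vec n"
  shows "(l2_norm (of_real t \<cdot>\<^sub>v u + v))\<^sup>2 = t\<^sup>2 * (l2_norm u)\<^sup>2 + 2 * t * re_inner u v + (l2_norm v)\<^sup>2"
proof -
  have "(cmod (of_real t * a + b))\<^sup>2 = t\<^sup>2 * (cmod a)\<^sup>2 + 2 * t * Re (a * cnj b) + (cmod b)\<^sup>2"
    for a b
    unfolding cmod_power2 by (simp add: power2_eq_square algebra_simps)
  then show ?thesis
    using assms by (simp add: l2_norm_sq re_inner_def sum.distrib sum_distrib_left del: times_complex.sel)
qed

lemma re_inner_le:
  assumes "dim_vec u = dim_vec v"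
  shows "re_inner u v \<le> l2_norm u * l2_norm v"
proof -
  have "re_inner u v \<le> (\<Sum>i<dim_vec u. \<bar>cmod (u $ i)\<bar> * \<bar>cmod (v $ i)\<bar>)"
    unfolding re_inner_def
    by (intro sum_mono) (metis abs_norm_cancel complex_Re_le_cmod complex_mod_cnj norm_mult)
  also have "\<dots> \<le> l2_norm u * l2_norm v"
    using assms L2_set_mult_ineq[of "\<lambda>i. cmod (u $ i)" "\<lambda>i. cmod (v $ i)" "{..<dim_vec u}"]
    by (simp add: l2_norm_def)
  finally show ?thesis .
qed

section \<open>The conjugate transpose as an adjoint\<close>

lemma mat_adjoint_carrier [simp]:
  "(M :: complex mat) \<in> carrier_mat m d \<Longrightarrow> mat_adjoint M \<in> carrier_mat d m"
  by (auto simp: mat_adjoint_def)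

lemma mat_adjoint_dim [simp]:
  "dim_row (mat_adjoint (M :: complex mat)) = dim_col M"
  "dim_col (mat_adjoint (M :: complex mat)) = dim_row M"
  by (auto simp: mat_adjoint_def)

lemma mat_adjoint_index:
  assumes "(M :: complex mat) \<in> carrier_mat m d" "i < d" "j < m"
  shows "mat_adjoint M $$ (i, j) = cnj (M $$ (j, i))"
  using assms by (simp add: mat_adjoint_def mat_of_rows_index)

lemma re_inner_adjoint:
  assumes M: "M \<in> carrier_mat m d" and y: "y \<in> carrier_vec m" and z: "z \<in> carrier_vec d"
  shows "re_inner (mat_adjoint M *\<^sub>v y) z = re_inner y (M *\<^sub>v z)"
proof -
  have 1: "(mat_adjoint M *\<^sub>v y) $ i = (\<Sum>j<m. cnj (M $$ (j, i)) * y $ j)" if "i < d" for i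
    using that M y mat_adjoint_carrier[OF M]
    by (simp add: scalar_prod_def mat_adjoint_index[OF M] lessThan_atLeast0)
  have 2: "(M *\<^sub>v z) $ j = (\<Sum>i<d. M $$ (j, i) * z $ i)" if "j < m" for j
    using that M z by (auto simp: scalar_prod_def lessThan_atLeast0 intro!: sum.cong)
  have "re_inner (mat_adjoint M *\<^sub>v y) z = Re (\<Sum>i<d. \<Sum>j<m. cnj (M $$ (j, i)) * y $ j * cnj (z $ i))"
    using M 1 unfolding re_inner_def
    by (simp add: sum_distrib_right del: times_complex.sel index_mult_mat_vec)
  also have "\<dots> = Re (\<Sum>j<m. \<Sum>i<d. cnj (M $$ (j, i)) * y $ j * cnj (z $ i))"
    by (subst sum.swap) simp
  also have "\<dots> = re_inner y (M *\<^sub>v z)"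
    using y by (simp add: re_inner_def 2 sum_distrib_left mult_ac del: times_complex.sel index_mult_mat_vec)
  finally show ?thesis .
qed

section \<open>Restriction to index sets\<close>

text \<open>Restriction by zeroing keeps the length, unlike \<open>vec_restrict\<close>, so vectors
  on different index sets can be added and compared without reindexing.\<close>

definition vmask :: "nat set \<Rightarrow> complex vec \<Rightarrow> complex vec" where
  "vmask V z = vec (dim_vec z) (\<lambda>i. if i \<in> V then z $ i else 0)"

lemma vmask_carrier [simp]: "z \<in> carrier_vec n \<Longrightarrow> vmask V z \<in> carrier_vec n"
  by (simp add: vmask_def)

lemma dim_vmask [simp]: "dim_vec (vmask V z) = dim_vec z"
  by (simp add: vmask_def)

lemma vmask_index [simp]: "i < dim_vec z \<Longrightarrow> vmask V z $ i = (if i \<in> V then z $ i else 0)"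
  by (simp add: vmask_def)

lemma vmask_add:
  "u \<in> carrier_vec n \<Longrightarrow> v \<in> carrier_vec n \<Longrightarrow> vmask V (u + v) = vmask V u + vmask V v"
  by auto

lemma supp_subset_dim: "supp z \<subseteq> {..<dim_vec z}"
  by (auto simp: supp_def)

lemma finite_supp [simp]: "finite (supp z)"
  using finite_subset[OF supp_subset_dim] by blast

lemma supp_vmask: "supp (vmask V z) = V \<inter> supp z"
  by (auto simp: supp_def split: if_splits)

lemma vmask_eq_self: "supp z \<subseteq> V \<Longrightarrow> vmask V z = z"
  by (rule eq_vecI) (auto simp: supp_def)

lemma vmask_eq_0: "z \<in> carrier_vec n \<Longrightarrow> supp z \<inter> V = {} \<Longrightarrow> vmask V z = 0\<^sub>v n"
  by (rule eq_vecI) (auto simp: supp_def)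

lemma vmask_compl: "z - vmask V z = vmask (- V) z"
  by auto

lemma supp_add:
  "u \<in> carrier_vec n \<Longrightarrow> v \<in> carrier_vec n \<Longrightarrow> supp (u + v) \<subseteq> supp u \<union> supp v"
  by (auto simp: supp_def)

lemma supp_diff:
  "u \<in> carrier_vec n \<Longrightarrow> v \<in> carrier_vec n \<Longrightarrow> supp (u - v) \<subseteq> supp u \<union> supp v"
  by (auto simp: supp_def)

lemma supp_smult: "supp (c \<cdot>\<^sub>v v) \<subseteq> supp v"
  by (auto simp: supp_def)

lemma l2_norm_vmask_sq:
  "(l2_norm (vmask V z))\<^sup>2 = (\<Sum>i\<in>V \<inter> {..<dim_vec z}. (cmod (z $ i))\<^sup>2)"
proof -
  have "(l2_norm (vmask V z))\<^sup>2 = (\<Sum>i<dim_vec z. if i \<in> V then (cmod (z $ i))\<^sup>2 else 0)"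
    unfolding l2_norm_sq by (auto intro!: sum.cong)
  then show ?thesis
    by (simp add: sum.inter_restrict[symmetric] Int_commute)
qed

lemma l1_norm_vmask:
  "l1_norm (vmask V z) = (\<Sum>i\<in>V \<inter> {..<dim_vec z}. cmod (z $ i))"
proof -
  have "l1_norm (vmask V z) = (\<Sum>i<dim_vec z. if i \<in> V then cmod (z $ i) else 0)"
    unfolding l1_norm_def by (auto intro!: sum.cong)
  then show ?thesis
    by (simp add: sum.inter_restrict[symmetric] Int_commute)
qed

lemma l2_norm_vmask_mono:
  assumes "V \<inter> supp z \<subseteq> W"
  shows "l2_norm (vmask V z) \<le> l2_norm (vmask W z)"
  unfolding l2_norm_def dim_vmask
  by (intro L2_set_mono) (use assms in \<open>auto simp: supp_def split: if_splits\<close>)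

lemma l2_norm_vmask_le: "l2_norm (vmask V z) \<le> l2_norm z"
  using l2_norm_vmask_mono[of V z UNIV] by (simp add: vmask_eq_self)

text \<open>Source of the duality arguments below: a bound on the pairing of \<open>u\<close> with
  the test vector \<open>g = vmask V u\<close> is a bound on the squared norm of
  \<open>g\<close>.\<close>

lemma re_inner_vmask: "re_inner u (vmask V u) = (l2_norm (vmask V u))\<^sup>2"
  unfolding re_inner_def l2_norm_sq
  by (rule sum.cong) (auto simp: cmod_power2 simp flip: power2_eq_square)

lemma l1_norm_split: "l1_norm z = l1_norm (vmask V z) + l1_norm (vmask (- V) z)"
proof -
  have "{..<dim_vec z} = V \<inter> {..<dim_vec z} \<union> - V \<inter> {..<dim_vec z}"
    by auto
  then have "l1_norm z = (\<Sum>i\<in>V \<inter> {..<dim_vec z} \<union> - V \<inter> {..<dim_vec z}. cmod (z $ i))"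
    by (simp add: l1_norm_def)
  also have "\<dots> = l1_norm (vmask V z) + l1_norm (vmask (- V) z)"
    unfolding l1_norm_vmask by (intro sum.union_disjoint) auto
  finally show ?thesis .
qed

lemma sparse_subset: "supp z \<subseteq> V \<Longrightarrow> finite V \<Longrightarrow> card V \<le> n \<Longrightarrow> sparse n z"
  unfolding sparse_def by (meson card_mono order_trans)

section \<open>Column submatrices\<close>

text \<open>Injectivity: \<open>j\<close> is recovered from \<open>pick T j\<close> as the number of
  elements of \<open>T\<close> below it (\<open>card_pick\<close>).\<close>

lemma bij_betw_pick:
  assumes "finite T"
  shows "bij_betw (pick T) {..<card T} T"
proof -
  have "inj_on (pick T) {..<card T}"
    by (rule inj_onI) (metis card_pick lessThan_iff)
  moreover have "pick T ` {..<card T} \<subseteq> T"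
    by (auto intro: pick_in_set)
  ultimately show ?thesis
    using assms by (simp add: bij_betw_def card_subset_eq card_image)
qed

lemma sum_pick: "finite T \<Longrightarrow> (\<Sum>j<card T. f (pick T j)) = sum f T"
  by (rule sum.reindex_bij_betw[OF bij_betw_pick])

lemma card_restrict: "T \<subseteq> {..<d} \<Longrightarrow> card {i. i < d \<and> i \<in> T} = card T"
  by (rule arg_cong[of _ _ card]) auto

lemma vec_restrict_carrier:
  "z \<in> carrier_vec d \<Longrightarrow> T \<subseteq> {..<d} \<Longrightarrow> vec_restrict z T \<in> carrier_vec (card T)"
  by (simp add: vec_restrict_def card_restrict)

lemma vec_restrict_index:
  "z \<in> carrier_vec d \<Longrightarrow> T \<subseteq> {..<d} \<Longrightarrow> j < card T \<Longrightarrow> vec_restrict z T $ j = z $ pick T j"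
  by (simp add: vec_restrict_def card_restrict)

lemma col_submatrix_carrier:
  "M \<in> carrier_mat m d \<Longrightarrow> T \<subseteq> {..<d} \<Longrightarrow> col_submatrix M T \<in> carrier_mat m (card T)"
  by (auto simp: col_submatrix_def dim_submatrix card_restrict)

lemma col_submatrix_index:
  assumes "M \<in> carrier_mat m d" "T \<subseteq> {..<d}" "i < m" "j < card T"
  shows "col_submatrix M T $$ (i, j) = M $$ (i, pick T j)"
  using assms by (simp add: col_submatrix_def submatrix_index card_restrict pick_UNIV)

text \<open>\<open>pick T\<close> reindexes the sum over the columns in \<open>T\<close>, and
  outside \<open>T\<close> the entries of \<open>z\<close> vanish. With the next two lemmas, claims
  about a column submatrix become claims about vectors supported in \<open>T\<close>.\<close>

lemma col_submatrix_mult: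
  assumes M: "M \<in> carrier_mat m d" and T: "T \<subseteq> {..<d}"
    and z: "z \<in> carrier_vec d" "supp z \<subseteq> T"
  shows "col_submatrix M T *\<^sub>v vec_restrict z T = M *\<^sub>v z"
proof (rule eq_vecI)
  fix i assume "i < dim_vec (M *\<^sub>v z)"
  then have i: "i < m" using M by simp
  have "(col_submatrix M T *\<^sub>v vec_restrict z T) $ i = (\<Sum>j<card T. M $$ (i, pick T j) * z $ pick T j)"
    using i col_submatrix_carrier[OF M T] vec_restrict_carrier[OF z(1) T]
    by (auto simp: scalar_prod_def lessThan_atLeast0 col_submatrix_index[OF M T i]
        vec_restrict_index[OF z(1) T] intro!: sum.cong)
  also have "\<dots> = (\<Sum>k\<in>T. M $$ (i, k) * z $ k)"
    using T by (intro sum_pick) (rule finite_subset, auto)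
  also have "\<dots> = (\<Sum>k<d. M $$ (i, k) * z $ k)"
    using T z by (intro sum.mono_neutral_left) (auto simp: supp_def)
  also have "\<dots> = (M *\<^sub>v z) $ i"
    using i M z by (auto simp: scalar_prod_def lessThan_atLeast0 intro!: sum.cong)
  finally show "(col_submatrix M T *\<^sub>v vec_restrict z T) $ i = (M *\<^sub>v z) $ i" .
qed (use M col_submatrix_carrier[OF M T] in auto)

lemma l2_norm_vec_restrict:
  assumes T: "T \<subseteq> {..<d}" and z: "z \<in> carrier_vec d" "supp z \<subseteq> T"
  shows "l2_norm (vec_restrict z T) = l2_norm z"
proof -
  have "(l2_norm (vec_restrict z T))\<^sup>2 = (\<Sum>j<card T. (cmod (z $ pick T j))\<^sup>2)"
    using vec_restrict_carrier[OF z(1) T] by (simp add: l2_norm_sq vec_restrict_index[OF z(1) T])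
  also have "\<dots> = (\<Sum>k\<in>T. (cmod (z $ k))\<^sup>2)"
    using T by (intro sum_pick[where f = "\<lambda>k. (cmod (z $ k))\<^sup>2"]) (rule finite_subset, auto)
  also have "\<dots> = (\<Sum>k<d. (cmod (z $ k))\<^sup>2)"
    using T z by (intro sum.mono_neutral_left) (auto simp: supp_def)
  also have "\<dots> = (l2_norm z)\<^sup>2"
    using z by (simp add: l2_norm_sq)
  finally show ?thesis by simp
qed

lemma vec_restrict_surj:
  assumes T: "T \<subseteq> {..<d}" and u: "u \<in> carrier_vec (card T)"
  obtains z where "z \<in> carrier_vec d" "supp z \<subseteq> T" "vec_restrict z T = u"
proof
  have fin: "finite T" using T by (rule finite_subset) simp
  \<comment> \<open>Zero extension: the entry of \<open>u\<close> belonging to \<open>i\<close> sits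
    at the rank of \<open>i\<close> in \<open>T\<close>, which inverts \<open>pick\<close>.\<close>
  let ?z = "vec d (\<lambda>i. if i \<in> T then u $ card {a \<in> T. a < i} else 0)"
  show z: "?z \<in> carrier_vec d" by simp
  show "supp ?z \<subseteq> T" by (auto simp: supp_def split: if_splits)
  show "vec_restrict ?z T = u"
  proof (rule eq_vecI)
    fix j assume "j < dim_vec u"
    then have j: "j < card T" using u by simp
    then have "pick T j \<in> T" by (intro pick_in_set) simp
    then show "vec_restrict ?z T $ j = u $ j"
      using j T by (auto simp: vec_restrict_index[OF z T j] card_pick)
  qed (use u vec_restrict_carrier[OF z T] in auto)
qed

section \<open>Spectral norms\<close>

text \<open>Cauchy-Schwarz row by row. Only the existence of a constant matters: it makes the
  supremum in \<open>spectral_norm\<close> that of a bounded set.\<close>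

lemma frobenius_bound:
  assumes M: "M \<in> carrier_mat m d"
  obtains B where "\<And>z. z \<in> carrier_vec d \<Longrightarrow> l2_norm (M *\<^sub>v z) \<le> B * l2_norm z"
proof
  fix z :: "complex vec" assume z: "z \<in> carrier_vec d"
  let ?r = "\<lambda>i. L2_set (\<lambda>j. cmod (M $$ (i, j))) {..<d}"
  have row: "cmod ((M *\<^sub>v z) $ i) \<le> ?r i * l2_norm z" if i: "i < m" for i
  proof -
    have "cmod ((M *\<^sub>v z) $ i) = cmod (\<Sum>j<d. M $$ (i, j) * z $ j)"
      using M z i by (auto simp: scalar_prod_def lessThan_atLeast0 intro!: arg_cong[of _ _ cmod] sum.cong)
    also have "\<dots> \<le> (\<Sum>j<d. \<bar>cmod (M $$ (i, j))\<bar> * \<bar>cmod (z $ j)\<bar>)"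
      by (rule order_trans[OF norm_sum]) (simp add: norm_mult)
    also have "\<dots> \<le> ?r i * L2_set (\<lambda>j. cmod (z $ j)) {..<d}"
      by (rule L2_set_mult_ineq)
    finally show ?thesis using z by (simp add: l2_norm_def)
  qed
  have "l2_norm (M *\<^sub>v z) \<le> L2_set (\<lambda>i. ?r i * l2_norm z) {..<m}"
    unfolding l2_norm_def[of "M *\<^sub>v z"] using M row by (auto intro!: L2_set_mono simp del: index_mult_mat_vec)
  also have "\<dots> = L2_set ?r {..<m} * l2_norm z"
    by (simp add: L2_set_left_distrib)
  finally show "l2_norm (M *\<^sub>v z) \<le> L2_set ?r {..<m} * l2_norm z" .
qed

lemma mult_mat_vec_zero:
  "(M :: complex mat) \<in> carrier_mat m d \<Longrightarrow> M *\<^sub>v 0\<^sub>v d = 0\<^sub>v m"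
  by auto

lemma bdd_above_unit_ball_image:
  "bdd_above ((\<lambda>z. l2_norm (M *\<^sub>v z)) ` {z \<in> carrier_vec (dim_col M). l2_norm z \<le> 1})"
proof -
  obtain B where B: "\<And>z. z \<in> carrier_vec (dim_col M) \<Longrightarrow> l2_norm (M *\<^sub>v z) \<le> B * l2_norm z"
    using frobenius_bound[of M "dim_row M" "dim_col M"] by blast
  show ?thesis
  proof (rule bdd_aboveI2)
    fix u assume u: "u \<in> {z \<in> carrier_vec (dim_col M). l2_norm z \<le> 1}"
    then have "l2_norm (M *\<^sub>v u) \<le> B * l2_norm u" using B by simp
    also have "B * l2_norm u \<le> \<bar>B\<bar> * 1"
      using u by (intro mult_mono) auto
    finally show "l2_norm (M *\<^sub>v u) \<le> \<bar>B\<bar>" by simp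
  qed
qed

lemma spectral_norm_bound:
  assumes M: "M \<in> carrier_mat m d" and z: "z \<in> carrier_vec d"
  shows "l2_norm (M *\<^sub>v z) \<le> spectral_norm M * l2_norm z"
proof (cases "l2_norm z = 0")
  case True
  then have "z = 0\<^sub>v d" using z l2_norm_eq_0_iff by blast
  then show ?thesis
    using M True by (simp add: mult_mat_vec_zero)
next
  case False
  let ?c = "complex_of_real (1 / l2_norm z)"
  have pos: "l2_norm z > 0" using False l2_norm_nonneg[of z] by linarith
  have "l2_norm (M *\<^sub>v (?c \<cdot>\<^sub>v z)) \<le> spectral_norm M"
    unfolding spectral_norm_def using M z pos
    by (intro cSUP_upper[OF _ bdd_above_unit_ball_image]) (simp add: l2_norm_smult norm_divide)
  moreover have "M *\<^sub>v (?c \<cdot>\<^sub>v z) = ?c \<cdot>\<^sub>v (M *\<^sub>v z)"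
    by (rule mult_mat_vec[OF M z])
  ultimately have "l2_norm (M *\<^sub>v z) / l2_norm z \<le> spectral_norm M"
    using pos by (simp add: l2_norm_smult norm_divide)
  then show ?thesis using pos by (simp add: field_simps)
qed

lemma spectral_norm_le:
  assumes M: "M \<in> carrier_mat m d" and K: "0 \<le> K"
    and bound: "\<And>z. z \<in> carrier_vec d \<Longrightarrow> l2_norm (M *\<^sub>v z) \<le> K * l2_norm z"
  shows "spectral_norm M \<le> K"
  unfolding spectral_norm_def
proof (rule cSUP_least)
  show "{z \<in> carrier_vec (dim_col M). l2_norm z \<le> 1} \<noteq> {}"
    by (auto intro!: exI[of _ "0\<^sub>v (dim_col M)"])
next
  fix z assume z: "z \<in> {z \<in> carrier_vec (dim_col M). l2_norm z \<le> 1}"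
  then have "l2_norm (M *\<^sub>v z) \<le> K * l2_norm z" using bound M by simp
  also have "\<dots> \<le> K" using z K by (simp add: mult_left_le)
  finally show "l2_norm (M *\<^sub>v z) \<le> K" .
qed

lemma spectral_norm_nonneg: "0 \<le> spectral_norm M"
proof -
  have "l2_norm (M *\<^sub>v 0\<^sub>v (dim_col M)) \<le> spectral_norm M"
    unfolding spectral_norm_def
    by (intro cSUP_upper[OF _ bdd_above_unit_ball_image]) auto
  then show ?thesis using l2_norm_nonneg order_trans by blast
qed

section \<open>Norms of column submatrices as norms on sparse vectors\<close>

lemma finite_col_sets: "finite {T. T \<subseteq> {..<d::nat} \<and> card T = k}"
  by (rule finite_subset[of _ "Pow {..<d}"]) auto

text \<open>\<open>spectral_norm_cols\<close> ranges over column sets of one fixed size, so a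
  smaller support has to be padded.\<close>

lemma obtain_col_set:
  assumes "V \<subseteq> {..<d::nat}" "card V \<le> n"
  obtains T where "V \<subseteq> T" "T \<subseteq> {..<d}" "card T = min n d"
proof -
  have "card V \<le> min n d" "min n d \<le> card {..<d}"
    using assms card_mono[OF _ assms(1)] by auto
  then show ?thesis
    using exists_subset_between[OF _ _ assms(1), of "min n d"] that by auto
qed

lemma spectral_norm_cols_bound:
  assumes M: "M \<in> carrier_mat m d" and z: "z \<in> carrier_vec d" "sparse n z"
  shows "l2_norm (M *\<^sub>v z) \<le> spectral_norm_cols n M * l2_norm z"
proof -
  obtain T where T: "supp z \<subseteq> T" "T \<subseteq> {..<d}" "card T = min n d"
    using obtain_col_set[of "supp z" d n] supp_subset_dim[of z] z by (auto simp: sparse_def)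
  have "l2_norm (M *\<^sub>v z) = l2_norm (col_submatrix M T *\<^sub>v vec_restrict z T)"
    using col_submatrix_mult[OF M T(2) z(1) T(1)] by simp
  also have "\<dots> \<le> spectral_norm (col_submatrix M T) * l2_norm (vec_restrict z T)"
    by (rule spectral_norm_bound[OF col_submatrix_carrier[OF M T(2)] vec_restrict_carrier[OF z(1) T(2)]])
  also have "\<dots> \<le> spectral_norm_cols n M * l2_norm (vec_restrict z T)"
    unfolding spectral_norm_cols_def using M T finite_col_sets
    by (intro mult_right_mono Max_ge) auto
  finally show ?thesis using l2_norm_vec_restrict[OF T(2) z(1) T(1)] by simp
qed

lemma col_set_exists: "\<exists>T. T \<subseteq> {..<d::nat} \<and> card T = min n d"
  using obtain_col_set[of "{}" d n] by auto

text \<open>Every vector on the chosen columns is the restriction of a sparse vector with the same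
  norm and the same image. With \<open>spectral_norm_cols_bound\<close>,
  \<open>spectral_norm_cols n M\<close> is thus the best constant on n-sparse vectors.\<close>

lemma spectral_norm_cols_le:
  assumes M: "M \<in> carrier_mat m d" and K: "0 \<le> K"
    and bound: "\<And>z. z \<in> carrier_vec d \<Longrightarrow> sparse n z \<Longrightarrow> l2_norm (M *\<^sub>v z) \<le> K * l2_norm z"
  shows "spectral_norm_cols n M \<le> K"
  unfolding spectral_norm_cols_def
proof (rule Max.boundedI)
  show "finite ((\<lambda>T. spectral_norm (col_submatrix M T)) ` {T. T \<subseteq> {..<dim_col M} \<and> card T = min n (dim_col M)})"
    using finite_col_sets by blast
  show "(\<lambda>T. spectral_norm (col_submatrix M T)) ` {T. T \<subseteq> {..<dim_col M} \<and> card T = min n (dim_col M)} \<noteq> {}"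
    using col_set_exists by auto
  fix r assume "r \<in> (\<lambda>T. spectral_norm (col_submatrix M T)) ` {T. T \<subseteq> {..<dim_col M} \<and> card T = min n (dim_col M)}"
  then obtain T where T: "T \<subseteq> {..<d}" "card T = min n d" and r: "r = spectral_norm (col_submatrix M T)"
    using M by auto
  show "r \<le> K"
    unfolding r
  proof (rule spectral_norm_le[OF col_submatrix_carrier[OF M T(1)] K])
    fix u :: "complex vec" assume "u \<in> carrier_vec (card T)"
    then obtain z where z: "z \<in> carrier_vec d" "supp z \<subseteq> T" "vec_restrict z T = u"
      using vec_restrict_surj[OF T(1)] by blast
    have "sparse n z" using z(2) T by (intro sparse_subset[of _ T]) (auto intro: finite_subset)
    then show "l2_norm (col_submatrix M T *\<^sub>v u) \<le> K * l2_norm u"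
      using bound[OF z(1)] col_submatrix_mult[OF M T(1) z(1,2)] l2_norm_vec_restrict[OF T(1) z(1,2)] z(3)
      by simp
  qed
qed

lemma spectral_norm_cols_nonneg: "0 \<le> spectral_norm_cols n M"
proof -
  obtain T where "T \<subseteq> {..<dim_col M}" "card T = min n (dim_col M)"
    using col_set_exists by blast
  then have "spectral_norm (col_submatrix M T) \<le> spectral_norm_cols n M"
    unfolding spectral_norm_cols_def using finite_col_sets by (intro Max_ge) auto
  then show ?thesis using spectral_norm_nonneg order_trans by blast
qed


section \<open>The restricted isometry property\<close>

lemma rip_upper:
  assumes "A \<in> carrier_mat m d" "rip A n \<delta>" "z \<in> carrier_vec d" "sparse n z"
  shows "l2_norm (A *\<^sub>v z) \<le> sqrt (1 + \<delta>) * l2_norm z"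
proof -
  have "(l2_norm (A *\<^sub>v z))\<^sup>2 \<le> (1 + \<delta>) * (l2_norm z)\<^sup>2"
    using assms by (simp add: rip_def)
  then have "sqrt ((l2_norm (A *\<^sub>v z))\<^sup>2) \<le> sqrt ((1 + \<delta>) * (l2_norm z)\<^sup>2)"
    by (rule real_sqrt_le_mono)
  then show ?thesis by (simp add: real_sqrt_mult)
qed

text \<open>\<open>sqrt\<close> is extended to negative reals as an odd function, monotone and
  multiplicative throughout, so \<open>1 - \<delta>\<close> may have any sign.\<close>

lemma rip_lower:
  assumes "A \<in> carrier_mat m d" "rip A n \<delta>" "z \<in> carrier_vec d" "sparse n z"
  shows "sqrt (1 - \<delta>) * l2_norm z \<le> l2_norm (A *\<^sub>v z)"
proof -
  have "(1 - \<delta>) * (l2_norm z)\<^sup>2 \<le> (l2_norm (A *\<^sub>v z))\<^sup>2"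
    using assms by (simp add: rip_def)
  then have "sqrt ((1 - \<delta>) * (l2_norm z)\<^sup>2) \<le> sqrt ((l2_norm (A *\<^sub>v z))\<^sup>2)"
    by (rule real_sqrt_le_mono)
  then show ?thesis by (simp add: real_sqrt_mult)
qed

lemma rip_mono:
  assumes "rip A n \<delta>" "k \<le> n"
  shows "rip A k \<delta>"
  using assms by (auto simp: rip_def sparse_def)

text \<open>A unit vector is a nonzero sparse vector, for which the two sides conflict if
  \<open>\<delta>\<close> is negative. Without such a vector every real would qualify, and there
  would be no least one.\<close>

lemma rip_nonneg:
  assumes A: "A \<in> carrier_mat m d" and "rip A n \<delta>" "0 < d" "0 < n"
  shows "0 \<le> \<delta>"
proof -
  let ?z = "unit_vec d 0 :: complex vec"
  have "supp ?z = {0}" using \<open>0 < d\<close> by (auto simp: supp_def unit_vec_def split: if_splits)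
  then have "sparse n ?z" using \<open>0 < n\<close> by (simp add: sparse_def)
  moreover have "?z \<noteq> 0\<^sub>v d" using \<open>0 < d\<close> by (metis index_unit_vec(1) index_zero_vec(1) zero_neq_one)
  then have "l2_norm ?z \<noteq> 0" using l2_norm_eq_0_iff[of ?z d] by simp
  then have pos: "0 < (l2_norm ?z)\<^sup>2" by simp
  ultimately have "(1 - \<delta>) * (l2_norm ?z)\<^sup>2 \<le> (l2_norm (A *\<^sub>v ?z))\<^sup>2"
    "(l2_norm (A *\<^sub>v ?z))\<^sup>2 \<le> (1 + \<delta>) * (l2_norm ?z)\<^sup>2"
    using assms(2) A by (auto simp: rip_def)
  then have "0 \<le> (2 * \<delta>) * (l2_norm ?z)\<^sup>2" by (simp add: algebra_simps)
  then show ?thesis using pos by (simp add: zero_le_mult_iff)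
qed

lemma rip_exists:
  assumes A: "A \<in> carrier_mat m d"
  shows "\<exists>\<delta>. rip A n \<delta>"
proof -
  \<comment> \<open>The 1 makes the lower inequality trivial; the squared spectral norm gives the
    upper one.\<close>
  define B where "B = max 1 ((spectral_norm A)\<^sup>2)"
  have "rip A n B"
    unfolding rip_def
  proof (intro ballI impI conjI)
    fix z :: "complex vec" assume z: "z \<in> carrier_vec (dim_col A)"
    have "(1 - B) * (l2_norm z)\<^sup>2 \<le> 0"
      by (rule mult_nonpos_nonneg) (auto simp: B_def)
    also have "0 \<le> (l2_norm (A *\<^sub>v z))\<^sup>2" by simp
    finally show "(1 - B) * (l2_norm z)\<^sup>2 \<le> (l2_norm (A *\<^sub>v z))\<^sup>2" .
    have "(l2_norm (A *\<^sub>v z))\<^sup>2 \<le> (spectral_norm A * l2_norm z)\<^sup>2"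
      using spectral_norm_bound[of A m d z] A z by (intro power_mono) auto
    also have "\<dots> \<le> (1 + B) * (l2_norm z)\<^sup>2"
      unfolding power_mult_distrib by (rule mult_right_mono) (auto simp: B_def)
    finally show "(l2_norm (A *\<^sub>v z))\<^sup>2 \<le> (1 + B) * (l2_norm z)\<^sup>2" .
  qed
  then show ?thesis by blast
qed

text \<open>For each nonzero \<open>z\<close> the two inequalities are lower bounds on
  \<open>\<delta>\<close>, hence pass to the infimum. This is what gives \<open>LEAST\<close> in
  \<open>ric\<close> a meaning.\<close>

lemma rip_Inf:
  assumes A: "A \<in> carrier_mat m d" and "0 < d" "0 < n"
  shows "rip A n (Inf {\<delta>. rip A n \<delta>})"
  unfolding rip_def[of A n "Inf {\<delta>. rip A n \<delta>}"]
proof (intro ballI impI)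
  fix z :: "complex vec" assume z: "z \<in> carrier_vec (dim_col A)" "sparse n z"
  let ?D = "{\<delta>. rip A n \<delta>}" and ?N = "(l2_norm z)\<^sup>2" and ?M = "(l2_norm (A *\<^sub>v z))\<^sup>2"
  have ne: "?D \<noteq> {}" using rip_exists[OF A] by blast
  show "(1 - Inf ?D) * ?N \<le> ?M \<and> ?M \<le> (1 + Inf ?D) * ?N"
  proof (cases "l2_norm z = 0")
    case True
    then have "z = 0\<^sub>v d" using z A l2_norm_eq_0_iff[of z d] by auto
    then have "l2_norm (A *\<^sub>v z) = 0" using A by (simp add: mult_mat_vec_zero)
    then show ?thesis using True by simp
  next
    case False
    then have pos: "0 < ?N" by simp
    have "1 - ?M / ?N \<le> Inf ?D"
    proof (rule cInf_greatest[OF ne])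
      fix \<delta> assume "\<delta> \<in> ?D"
      then have "(1 - \<delta>) * ?N \<le> ?M" using z by (auto simp: rip_def)
      then show "1 - ?M / ?N \<le> \<delta>" using pos by (simp add: field_simps)
    qed
    moreover have "?M / ?N - 1 \<le> Inf ?D"
    proof (rule cInf_greatest[OF ne])
      fix \<delta> assume "\<delta> \<in> ?D"
      then have "?M \<le> (1 + \<delta>) * ?N" using z by (auto simp: rip_def)
      then show "?M / ?N - 1 \<le> \<delta>" using pos by (simp add: field_simps)
    qed
    ultimately show ?thesis using pos by (simp add: field_simps)
  qed
qed

lemma ric_eq_Inf:
  assumes A: "A \<in> carrier_mat m d" and "0 < d" "0 < n"
  shows "ric A n = Inf {\<delta>. rip A n \<delta>}"
proof -
  have "Inf {\<delta>. rip A n \<delta>} \<le> \<delta>" if "rip A n \<delta>" for \<delta>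
    using that rip_nonneg[OF A _ assms(2,3)] by (intro cInf_lower) (auto intro!: bdd_belowI[of _ 0])
  then show ?thesis
    unfolding ric_def using rip_Inf[OF assms] by (intro Least_equality) auto
qed

lemma rip_ric:
  assumes "A \<in> carrier_mat m d" "0 < d" "0 < n"
  shows "rip A n (ric A n)"
  using rip_Inf[OF assms] ric_eq_Inf[OF assms] by simp

lemma ric_le:
  assumes "A \<in> carrier_mat m d" "0 < d" "0 < n" "rip A n \<delta>"
  shows "ric A n \<le> \<delta>"
  unfolding ric_eq_Inf[OF assms(1-3)] using assms(4) rip_nonneg[OF assms(1) _ assms(2,3)]
  by (intro cInf_lower) (auto intro!: bdd_belowI[of _ 0])

section \<open>Gram matrix and adjoint on small index sets\<close>

lemma finite_nat_sets: "V \<subseteq> {..<n::nat} \<Longrightarrow> finite V"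
  by (rule finite_subset) auto

text \<open>The off-diagonal part of the Gram matrix is controlled by applying the two sides of the
  restricted isometry property to \<open>g + \<delta> z\<close> and \<open>g - \<delta> z\<close>, where \<open>g\<close> is the vector to be bounded;
  the weight \<open>\<delta>\<close> makes normalization unnecessary.\<close>

lemma rip_gram_residual:
  assumes M: "M \<in> carrier_mat m d" and rip: "rip M n \<delta>" and "0 < \<delta>"
    and z: "z \<in> carrier_vec d" and V: "finite V" "card (V \<union> supp z) \<le> n"
  shows "l2_norm (vmask V (mat_adjoint M *\<^sub>v (M *\<^sub>v z) - z)) \<le> \<delta> * l2_norm z"
proof -
  let ?E = "mat_adjoint M *\<^sub>v (M *\<^sub>v z) - z"
  define g where "g = vmask V ?E"
  have Mz: "M *\<^sub>v z \<in> carrier_vec m" using M z by simp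
  have aMz: "mat_adjoint M *\<^sub>v (M *\<^sub>v z) \<in> carrier_vec d"
    using mult_mat_vec_carrier[OF mat_adjoint_carrier[OF M] Mz] .
  have g: "g \<in> carrier_vec d" using aMz z by (simp add: g_def)
  have sg: "supp g \<subseteq> V" by (auto simp: g_def supp_vmask)
  \<comment> \<open>Pairing \<open>?E\<close> with its own restriction \<open>g\<close> gives the
    squared norm of \<open>g\<close>; moving the adjoint across leaves quantities that the isometry
    property controls.\<close>
  have inner: "re_inner (M *\<^sub>v z) (M *\<^sub>v g) - re_inner z g = (l2_norm g)\<^sup>2"
    using re_inner_diff_left[OF aMz z, of g] re_inner_adjoint[OF M Mz g] re_inner_vmask[of ?E V]
    by (simp add: g_def)
  have comb: "of_real t \<cdot>\<^sub>v z + g \<in> carrier_vec d \<and> sparse n (of_real t \<cdot>\<^sub>v z + g) \<and>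
      M *\<^sub>v (of_real t \<cdot>\<^sub>v z + g) = of_real t \<cdot>\<^sub>v (M *\<^sub>v z) + M *\<^sub>v g" for t :: real
  proof (intro conjI)
    show "sparse n (of_real t \<cdot>\<^sub>v z + g)"
      using supp_add[of "of_real t \<cdot>\<^sub>v z" d g] supp_smult[of "of_real t" z] z g sg V
      by (intro sparse_subset[of _ "V \<union> supp z"]) auto
    show "M *\<^sub>v (of_real t \<cdot>\<^sub>v z + g) = of_real t \<cdot>\<^sub>v (M *\<^sub>v z) + M *\<^sub>v g"
      using M z g by (simp add: mult_add_distrib_mat_vec[OF M] mult_mat_vec[OF M])
  qed (use z g in auto)
  have Mg: "M *\<^sub>v g \<in> carrier_vec m" using M g by simp
  have up: "\<delta>\<^sup>2 * (l2_norm (M *\<^sub>v z))\<^sup>2 + 2 * \<delta> * re_inner (M *\<^sub>v z) (M *\<^sub>v g) + (l2_norm (M *\<^sub>v g))\<^sup>2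
      \<le> (1 + \<delta>) * (\<delta>\<^sup>2 * (l2_norm z)\<^sup>2 + 2 * \<delta> * re_inner z g + (l2_norm g)\<^sup>2)"
    using rip comb[of \<delta>] M unfolding rip_def
      l2_norm_lincomb_sq[OF z g, symmetric] l2_norm_lincomb_sq[OF Mz Mg, symmetric] by auto
  have low: "(1 - \<delta>) * ((-\<delta>)\<^sup>2 * (l2_norm z)\<^sup>2 + 2 * (-\<delta>) * re_inner z g + (l2_norm g)\<^sup>2)
      \<le> (-\<delta>)\<^sup>2 * (l2_norm (M *\<^sub>v z))\<^sup>2 + 2 * (-\<delta>) * re_inner (M *\<^sub>v z) (M *\<^sub>v g) + (l2_norm (M *\<^sub>v g))\<^sup>2"
    using rip comb[of "-\<delta>"] M unfolding rip_def
      l2_norm_lincomb_sq[OF z g, symmetric] l2_norm_lincomb_sq[OF Mz Mg, symmetric] by auto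
  \<comment> \<open>Adding \<open>up\<close> and \<open>low\<close> cancels the squared norms of
    \<open>M *\<^sub>v z\<close> and \<open>M *\<^sub>v g\<close>. Afterwards the squared norm of
    \<open>g\<close> on the right is absorbed into the two copies on the left.\<close>
  have "4 * \<delta> * (re_inner (M *\<^sub>v z) (M *\<^sub>v g) - re_inner z g) \<le> 2 * \<delta> * (\<delta>\<^sup>2 * (l2_norm z)\<^sup>2 + (l2_norm g)\<^sup>2)"
    using up low by (simp add: algebra_simps)
  then have "2 * \<delta> * (2 * (l2_norm g)\<^sup>2) \<le> 2 * \<delta> * (\<delta>\<^sup>2 * (l2_norm z)\<^sup>2 + (l2_norm g)\<^sup>2)"
    unfolding inner by (simp add: algebra_simps)
  then have "(l2_norm g)\<^sup>2 \<le> (\<delta> * l2_norm z)\<^sup>2"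
    using \<open>0 < \<delta>\<close> by (simp add: mult_le_cancel_left power_mult_distrib)
  then show ?thesis
    using \<open>0 < \<delta>\<close> by (fold g_def) (rule power2_le_imp_le, auto)
qed

text \<open>Duality: the squared norm of the restriction \<open>g\<close> is the pairing of
  \<open>e\<close> with \<open>M *\<^sub>v g\<close>, and \<open>g\<close> itself is sparse.\<close>

lemma rip_adjoint:
  assumes M: "M \<in> carrier_mat m d" and rip: "rip M n \<delta>" and "0 \<le> \<delta>"
    and e: "e \<in> carrier_vec m" and V: "finite V" "card V \<le> n"
  shows "l2_norm (vmask V (mat_adjoint M *\<^sub>v e)) \<le> sqrt (1 + \<delta>) * l2_norm e"
proof -
  define g where "g = vmask V (mat_adjoint M *\<^sub>v e)"
  have g: "g \<in> carrier_vec d"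
    unfolding g_def using mult_mat_vec_carrier[OF mat_adjoint_carrier[OF M] e] by simp
  have "sparse n g" using V by (intro sparse_subset[of _ V]) (auto simp: g_def supp_vmask)
  then have "l2_norm (M *\<^sub>v g) \<le> sqrt (1 + \<delta>) * l2_norm g"
    by (rule rip_upper[OF M rip g])
  then have "l2_norm e * l2_norm (M *\<^sub>v g) \<le> l2_norm e * (sqrt (1 + \<delta>) * l2_norm g)"
    by (rule mult_left_mono) simp
  moreover have "(l2_norm g)\<^sup>2 = re_inner e (M *\<^sub>v g)"
    using re_inner_adjoint[OF M e g] re_inner_vmask[of "mat_adjoint M *\<^sub>v e" V] by (simp add: g_def)
  moreover have "re_inner e (M *\<^sub>v g) \<le> l2_norm e * l2_norm (M *\<^sub>v g)"
    using M e by (intro re_inner_le) simp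
  ultimately have "l2_norm g * l2_norm g \<le> l2_norm g * (sqrt (1 + \<delta>) * l2_norm e)"
    by (simp add: power2_eq_square mult_ac)
  then have "l2_norm g \<le> sqrt (1 + \<delta>) * l2_norm e"
    using \<open>0 \<le> \<delta>\<close> by (cases "l2_norm g = 0") (auto simp: mult_le_cancel_left less_le)
  then show ?thesis by (simp add: g_def)
qed

section \<open>Largest components\<close>

text \<open>\<open>S\<close> has at least as many elements as \<open>R\<close>, so
  \<open>R - S\<close> injects into \<open>S - R\<close>, and every entry on \<open>S\<close>
  dominates every entry outside it.\<close>

lemma largest_swap:
  assumes w: "w \<in> carrier_vec d"
    and S: "S \<subseteq> {..<d}" "card S = min r d"
      "\<forall>i\<in>S. \<forall>j\<in>{..<d} - S. cmod (w $ j) \<le> cmod (w $ i)"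
    and R: "R \<subseteq> {..<d}" "card R \<le> r"
  shows "l2_norm (vmask (R - S) w) \<le> l2_norm (vmask (S - R) w)"
proof -
  have fin: "finite S" "finite R" using S R by (auto intro: finite_nat_sets)
  have "card R \<le> card S" using R S card_mono[OF _ R(1)] by simp
  then have "card (R - S) \<le> card (S - R)"
    using fin card_Int_Diff[of R S] card_Int_Diff[of S R] by (simp add: Int_commute)
  then obtain f where f: "f ` (R - S) \<subseteq> S - R" "inj_on f (R - S)"
    using card_le_inj[of "R - S" "S - R"] fin by auto
  have "(l2_norm (vmask (R - S) w))\<^sup>2 = (\<Sum>j\<in>R - S. (cmod (w $ j))\<^sup>2)"
    unfolding l2_norm_vmask_sq using w R by (intro sum.cong) auto
  also have "\<dots> \<le> (\<Sum>j\<in>R - S. (cmod (w $ f j))\<^sup>2)"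
  proof (intro sum_mono power_mono)
    fix j assume j: "j \<in> R - S"
    then have "f j \<in> S" using f(1) by blast
    then show "cmod (w $ j) \<le> cmod (w $ f j)" using S(3) R(1) j by blast
  qed auto
  also have "\<dots> = (\<Sum>i\<in>f ` (R - S). (cmod (w $ i))\<^sup>2)"
    using sum.reindex[OF f(2), of "\<lambda>i. (cmod (w $ i))\<^sup>2"] by simp
  also have "\<dots> \<le> (\<Sum>i\<in>S - R. (cmod (w $ i))\<^sup>2)"
    using f fin by (intro sum_mono2) auto
  also have "\<dots> = (l2_norm (vmask (S - R) w))\<^sup>2"
    unfolding l2_norm_vmask_sq using w S by (intro sum.cong) auto
  finally show ?thesis by (rule power2_le_imp_le) simp
qed

lemma largest_partE:
  assumes "largest_part r z z'" "z \<in> carrier_vec d"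
  obtains S where "S \<subseteq> {..<d}" "card S = min r d"
    "\<forall>i\<in>S. \<forall>j\<in>{..<d} - S. cmod (z $ j) \<le> cmod (z $ i)" "z' = vmask S z"
  using assms by (auto simp: largest_part_def vmask_def)

lemma largest_part_carrier:
  "largest_part r z z' \<Longrightarrow> z \<in> carrier_vec d \<Longrightarrow> z' \<in> carrier_vec d"
  by (elim largest_partE) auto

lemma largest_part_sparse:
  assumes "largest_part r z z'" "z \<in> carrier_vec d"
  shows "sparse r z'"
proof -
  obtain S where "S \<subseteq> {..<d}" "card S = min r d" "z' = vmask S z"
    using largest_partE[OF assms] by metis
  then show ?thesis
    by (intro sparse_subset[of _ S]) (auto simp: supp_vmask intro: finite_nat_sets)
qed

text \<open>The complements of \<open>S\<close> and of \<open>R = supp x\<close> share the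
  complement of the union and differ in \<open>R - S\<close> against \<open>S - R\<close>, which
  \<open>largest_swap\<close> compares. Off \<open>R\<close>, \<open>w\<close> agrees with
  \<open>w - x\<close>.\<close>

lemma largest_part_best:
  assumes lp: "largest_part r w w'" and w: "w \<in> carrier_vec d"
    and x: "x \<in> carrier_vec d" "sparse r x"
  shows "l2_norm (w - w') \<le> l2_norm (w - x)"
proof -
  obtain S where S: "S \<subseteq> {..<d}" "card S = min r d"
      "\<forall>i\<in>S. \<forall>j\<in>{..<d} - S. cmod (w $ j) \<le> cmod (w $ i)" "w' = vmask S w"
    using largest_partE[OF lp w] .
  define R where "R = supp x"
  have R: "R \<subseteq> {..<d}" "card R \<le> r" using x supp_subset_dim[of x] by (auto simp: R_def sparse_def)
  have split: "(l2_norm (vmask (- P) w))\<^sup>2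
      = (l2_norm (vmask (Q - P) w))\<^sup>2 + (l2_norm (vmask (- (P \<union> Q)) w))\<^sup>2" for P Q
  proof -
    have "- P \<inter> {..<dim_vec w} = ((Q - P) \<inter> {..<dim_vec w}) \<union> (- (P \<union> Q) \<inter> {..<dim_vec w})"
      by auto
    then show ?thesis
      unfolding l2_norm_vmask_sq by (simp only:) (rule sum.union_disjoint, auto)
  qed
  have "(l2_norm (vmask (R - S) w))\<^sup>2 \<le> (l2_norm (vmask (S - R) w))\<^sup>2"
    using largest_swap[OF w S(1-3) R] by (intro power_mono) auto
  then have "(l2_norm (vmask (- S) w))\<^sup>2 \<le> (l2_norm (vmask (- R) w))\<^sup>2"
    using split[of S R] split[of R S] by (simp add: Un_commute)
  then have "l2_norm (vmask (- S) w) \<le> l2_norm (vmask (- R) w)"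
    by (rule power2_le_imp_le) simp
  also have "vmask (- R) w = vmask (- R) (w - x)"
    using w x by (intro eq_vecI) (auto simp: R_def supp_def)
  also have "l2_norm \<dots> \<le> l2_norm (w - x)" by (rule l2_norm_vmask_le)
  finally show ?thesis by (simp add: S(4) vmask_compl)
qed

text \<open>One copy of the distance leads from \<open>x\<close> to \<open>w\<close>; the other pays
  for pruning, which is no worse than replacing \<open>w\<close> by the sparse
  \<open>x\<close>.\<close>

lemma largest_part_error:
  assumes "largest_part r w w'" "w \<in> carrier_vec d" "x \<in> carrier_vec d" "sparse r x"
  shows "l2_norm (x - w') \<le> 2 * l2_norm (x - w)"
  using l2_norm_triangle_mid[of x d w w'] largest_part_best[OF assms] largest_part_carrier[OF assms(1,2)]
    l2_norm_minus_commute[OF assms(2,3)] assms by simp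

section \<open>The pseudoinverse of a matrix with independent columns\<close>

lemma mat_adjoint_mult:
  assumes "(A :: complex mat) \<in> carrier_mat k m" "B \<in> carrier_mat m n"
  shows "mat_adjoint (A * B) = mat_adjoint B * mat_adjoint A"
proof (rule eq_matI)
  fix i j assume "i < dim_row (mat_adjoint B * mat_adjoint A)" "j < dim_col (mat_adjoint B * mat_adjoint A)"
  then have ij: "i < n" "j < k" using assms by auto
  have AB: "A * B \<in> carrier_mat k n" using assms by simp
  show "mat_adjoint (A * B) $$ (i, j) = (mat_adjoint B * mat_adjoint A) $$ (i, j)"
    using ij assms
    by (simp add: mat_adjoint_index[OF AB] scalar_prod_def mat_adjoint_index[OF assms(1)]
        mat_adjoint_index[OF assms(2)] mult.commute)
qed (use assms in auto)

lemma mat_adjoint_adjoint [simp]: "mat_adjoint (mat_adjoint A) = (A :: complex mat)"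
proof (rule eq_matI)
  fix i j assume "i < dim_row A" "j < dim_col A"
  then show "mat_adjoint (mat_adjoint A) $$ (i, j) = A $$ (i, j)"
    using mat_adjoint_index[of "mat_adjoint A" "dim_col A" "dim_row A" i j]
      mat_adjoint_index[of A "dim_row A" "dim_col A" j i] by simp
qed auto

lemma mat_adjoint_one: "mat_adjoint (1\<^sub>m n) = (1\<^sub>m n :: complex mat)"
  by (rule eq_matI) (auto simp: mat_adjoint_index[of _ n n])

text \<open>A kernel vector \<open>u\<close> of the Gram matrix satisfies
  \<open>N *\<^sub>v u = 0\<close>: pair the Gram image with \<open>u\<close>.\<close>

lemma gram_inverse:
  assumes N: "(N :: complex mat) \<in> carrier_mat m t"
    and inj: "\<And>u. u \<in> carrier_vec t \<Longrightarrow> N *\<^sub>v u = 0\<^sub>v m \<Longrightarrow> u = 0\<^sub>v t"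
  obtains H where "H \<in> carrier_mat t t" "H * (mat_adjoint N * N) = 1\<^sub>m t" "(mat_adjoint N * N) * H = 1\<^sub>m t"
proof -
  let ?G = "mat_adjoint N * N"
  have G: "?G \<in> carrier_mat t t" using mult_carrier_mat[OF mat_adjoint_carrier[OF N] N] .
  have "det ?G \<noteq> 0"
  proof
    assume "det ?G = 0"
    then obtain u where u: "u \<in> carrier_vec t" "u \<noteq> 0\<^sub>v t" "?G *\<^sub>v u = 0\<^sub>v t"
      using det_0_iff_vec_prod_zero[OF G] by blast
    have Nu: "N *\<^sub>v u \<in> carrier_vec m" using N u by simp
    have "mat_adjoint N *\<^sub>v (N *\<^sub>v u) = 0\<^sub>v t"
      using u(3) assoc_mult_mat_vec[OF mat_adjoint_carrier[OF N] N u(1)] by simp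
    then have "(l2_norm (N *\<^sub>v u))\<^sup>2 = re_inner (0\<^sub>v t) u"
      using re_inner_adjoint[OF N Nu u(1)] by (simp add: re_inner_self)
    then have "l2_norm (N *\<^sub>v u) = 0" by (simp add: re_inner_def)
    then show False using inj[OF u(1)] u(2) l2_norm_eq_0_iff[OF Nu] by blast
  qed
  from det_non_zero_imp_unit[OF G this, of "()"]
  obtain H where "H \<in> carrier_mat t t" "H * ?G = 1\<^sub>m t" "?G * H = 1\<^sub>m t"
    by (auto simp: Units_def ring_mat_simps)
  then show ?thesis by (rule that)
qed

text \<open>The pseudoinverse is the inverse Gram matrix times the adjoint. Only the normal
  equations are exported, as they are all that least squares requires.\<close>

lemma pseudoinverse_injective:
  assumes N: "(N :: complex mat) \<in> carrier_mat m t"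
    and inj: "\<And>u. u \<in> carrier_vec t \<Longrightarrow> N *\<^sub>v u = 0\<^sub>v m \<Longrightarrow> u = 0\<^sub>v t"
  shows "pseudoinverse N \<in> carrier_mat t m"
    and "mat_adjoint N * (N * pseudoinverse N) = mat_adjoint N"
proof -
  let ?N' = "mat_adjoint N"
  obtain H where H: "H \<in> carrier_mat t t" "H * (?N' * N) = 1\<^sub>m t" "(?N' * N) * H = 1\<^sub>m t"
    using gram_inverse[OF assms] .
  have N': "?N' \<in> carrier_mat t m" using N by simp
  have G: "?N' * N \<in> carrier_mat t t" using mult_carrier_mat[OF N' N] .
  have HN': "H * ?N' \<in> carrier_mat t m" using mult_carrier_mat[OF H(1) N'] .
  have adjG: "mat_adjoint (?N' * N) = ?N' * N"
    by (simp add: mat_adjoint_mult[OF N' N])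
  \<comment> \<open>The adjoint of \<open>H\<close> is a right inverse of the self-adjoint Gram
    matrix, hence equals its inverse \<open>H\<close>.\<close>
  have adjH: "mat_adjoint H = H"
  proof -
    have aH: "mat_adjoint H \<in> carrier_mat t t" using H by simp
    have "(?N' * N) * mat_adjoint H = mat_adjoint (H * (?N' * N))"
      using mat_adjoint_mult[OF H(1) G] adjG by simp
    then have "(?N' * N) * mat_adjoint H = 1\<^sub>m t" by (simp add: H(2) mat_adjoint_one)
    then have "H * ((?N' * N) * mat_adjoint H) = H" using H(1) by simp
    then show ?thesis
      using assoc_mult_mat[OF H(1) G aH] H(2) left_mult_one_mat[OF aH] by metis
  qed
  have XN: "H * ?N' * N = 1\<^sub>m t"
    using assoc_mult_mat[OF H(1) N' N] H(2) by simp
  have NX: "N * (H * ?N') \<in> carrier_mat m m" using mult_carrier_mat[OF N HN'] .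
  have penrose: "N * (H * ?N') * N = N" "H * ?N' * N * (H * ?N') = H * ?N'"
    "mat_adjoint (N * (H * ?N')) = N * (H * ?N')" "mat_adjoint (H * ?N' * N) = H * ?N' * N"
  proof -
    show "N * (H * ?N') * N = N"
      using assoc_mult_mat[OF N HN' N] XN N by simp
    show "H * ?N' * N * (H * ?N') = H * ?N'"
      unfolding XN using left_mult_one_mat[OF HN'] .
    show "mat_adjoint (N * (H * ?N')) = N * (H * ?N')"
      by (simp add: mat_adjoint_mult[OF N HN'] mat_adjoint_mult[OF H(1) N'] adjH assoc_mult_mat[OF N H(1) N'])
    show "mat_adjoint (H * ?N' * N) = H * ?N' * N"
      by (simp add: XN mat_adjoint_one)
  qed
  \<comment> \<open>Two Penrose equations already give the normal equations; this serves both the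
    uniqueness of \<open>X\<close> and the final claim.\<close>
  have normal: "?N' * (N * X) = ?N'"
    if X: "X \<in> carrier_mat t m" "N * X * N = N" "mat_adjoint (N * X) = N * X" for X
  proof -
    have "?N' * (N * X) = mat_adjoint (N * X * N)"
      using mat_adjoint_mult[of "N * X" m m N t] N X by simp
    then show ?thesis using X(2) by simp
  qed
  have "pseudoinverse N = H * ?N'"
    unfolding pseudoinverse_def
  proof (rule the_equality)
    show "H * ?N' \<in> carrier_mat (dim_col N) (dim_row N) \<and> N * (H * ?N') * N = N \<and>
        H * ?N' * N * (H * ?N') = H * ?N' \<and> mat_adjoint (N * (H * ?N')) = N * (H * ?N') \<and>
        mat_adjoint (H * ?N' * N) = H * ?N' * N"
      using penrose HN' N by auto
  next
    fix X assume "X \<in> carrier_mat (dim_col N) (dim_row N) \<and> N * X * N = N \<and> X * N * X = X \<and>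
        mat_adjoint (N * X) = N * X \<and> mat_adjoint (X * N) = X * N"
    then have X: "X \<in> carrier_mat t m" "N * X * N = N" "mat_adjoint (N * X) = N * X"
      using N by auto
    have "H * ?N' = H * (?N' * (N * X))" using normal[OF X] by simp
    also have "\<dots> = (H * (?N' * N)) * X"
      using assoc_mult_mat[OF N' N X(1)] assoc_mult_mat[OF H(1) G X(1)] by simp
    finally show "X = H * ?N'" using H(2) X(1) by simp
  qed
  then show "pseudoinverse N \<in> carrier_mat t m" "?N' * (N * pseudoinverse N) = ?N'"
    using HN' normal[OF HN' penrose(1,3)] by simp_all
qed

text \<open>Lifts the normal equations from the submatrix to full length: the least squares residual
  is uncorrelated with the columns in \<open>T\<close>.\<close>

lemma least_squares_normal_equations:
  assumes M: "M \<in> carrier_mat m d" and T: "T \<subseteq> {..<d}"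
    and inj: "\<And>z. z \<in> carrier_vec d \<Longrightarrow> supp z \<subseteq> T \<Longrightarrow> M *\<^sub>v z = 0\<^sub>v m \<Longrightarrow> z = 0\<^sub>v d"
    and w: "w \<in> carrier_vec d" "supp w \<subseteq> T" and y: "y \<in> carrier_vec m"
    and ls: "vec_restrict w T = pseudoinverse (col_submatrix M T) *\<^sub>v y"
  shows "vmask T (mat_adjoint M *\<^sub>v (M *\<^sub>v w - y)) = 0\<^sub>v d"
proof -
  let ?N = "col_submatrix M T"
  have N: "?N \<in> carrier_mat m (card T)" using col_submatrix_carrier[OF M T] .
  have Ninj: "u = 0\<^sub>v (card T)" if u: "u \<in> carrier_vec (card T)" "?N *\<^sub>v u = 0\<^sub>v m" for u
  proof -
    obtain z where z: "z \<in> carrier_vec d" "supp z \<subseteq> T" "vec_restrict z T = u"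
      using vec_restrict_surj[OF T u(1)] by blast
    have "l2_norm u = l2_norm z" using l2_norm_vec_restrict[OF T z(1,2)] z(3) by simp
    moreover have "z = 0\<^sub>v d" using inj[OF z(1,2)] col_submatrix_mult[OF M T z(1,2)] u(2) z(3) by simp
    ultimately show ?thesis using l2_norm_eq_0_iff[OF u(1)] by simp
  qed
  let ?P = "pseudoinverse ?N"
  have P: "?P \<in> carrier_mat (card T) m" and normal: "mat_adjoint ?N * (?N * ?P) = mat_adjoint ?N"
    using pseudoinverse_injective[OF N] Ninj by blast+
  have N': "mat_adjoint ?N \<in> carrier_mat (card T) m" using N by simp
  have Py: "?P *\<^sub>v y \<in> carrier_vec (card T)" using P y by simp
  have Mw: "M *\<^sub>v w = ?N *\<^sub>v (?P *\<^sub>v y)"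
    using col_submatrix_mult[OF M T w] ls by simp
  have "mat_adjoint ?N *\<^sub>v (M *\<^sub>v w) = (mat_adjoint ?N * (?N * ?P)) *\<^sub>v y"
    unfolding Mw assoc_mult_mat_vec[OF N' mult_carrier_mat[OF N P] y] assoc_mult_mat_vec[OF N P y] ..
  then have "mat_adjoint ?N *\<^sub>v (M *\<^sub>v w) = mat_adjoint ?N *\<^sub>v y"
    using normal by simp
  then have zero: "mat_adjoint ?N *\<^sub>v (M *\<^sub>v w - y) = 0\<^sub>v (card T)"
    using mult_minus_distrib_mat_vec[OF N' mult_mat_vec_carrier[OF M w(1)] y]
      minus_cancel_vec[OF mult_mat_vec_carrier[OF N' y]] by simp
  \<comment> \<open>The correlation on \<open>T\<close> is tested against itself; being supported in
    \<open>T\<close>, it can be moved to the submatrix, where the normal equations apply.\<close>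
  define g where "g = vmask T (mat_adjoint M *\<^sub>v (M *\<^sub>v w - y))"
  have r: "M *\<^sub>v w - y \<in> carrier_vec m" using M w y by simp
  have g: "g \<in> carrier_vec d"
    unfolding g_def using mult_mat_vec_carrier[OF mat_adjoint_carrier[OF M] r] by simp
  have sg: "supp g \<subseteq> T" by (auto simp: g_def supp_vmask)
  have "(l2_norm g)\<^sup>2 = re_inner (M *\<^sub>v w - y) (M *\<^sub>v g)"
    using re_inner_adjoint[OF M r g] re_inner_vmask[of "mat_adjoint M *\<^sub>v (M *\<^sub>v w - y)" T]
    by (simp add: g_def)
  also have "\<dots> = re_inner (M *\<^sub>v w - y) (?N *\<^sub>v vec_restrict g T)"
    using col_submatrix_mult[OF M T g sg] by simp
  also have "\<dots> = re_inner (mat_adjoint ?N *\<^sub>v (M *\<^sub>v w - y)) (vec_restrict g T)"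
    using re_inner_adjoint[OF N r vec_restrict_carrier[OF g T]] by simp
  also have "\<dots> = 0"
    unfolding zero by (simp add: re_inner_def)
  finally show ?thesis using l2_norm_eq_0_iff[OF g] by (simp add: g_def)
qed


section \<open>The energy bound\<close>

lemma exists_largest_set:
  fixes f :: "nat \<Rightarrow> real"
  assumes "r \<le> d"
  shows "\<exists>S\<subseteq>{..<d}. card S = r \<and> (\<forall>i\<in>S. \<forall>j\<in>{..<d} - S. f j \<le> f i)"
  using assms
proof (induction r)
  case 0
  show ?case by (intro exI[of _ "{}"]) auto
next
  case (Suc r)
  then obtain S where S: "S \<subseteq> {..<d}" "card S = r" "\<forall>i\<in>S. \<forall>j\<in>{..<d} - S. f j \<le> f i"
    by auto
  have fin: "finite S" using S(1) by (rule finite_nat_sets)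
  have "{..<d} - S \<noteq> {}" using S Suc.prems card_mono[OF fin, of "{..<d}"] by auto
  then have "Max (f ` ({..<d} - S)) \<in> f ` ({..<d} - S)" by (intro Max_in) auto
  then obtain k where k: "k \<in> {..<d} - S" "Max (f ` ({..<d} - S)) = f k" by auto
  have k_max: "f j \<le> f k" if "j \<in> {..<d} - S" for j
    using that by (subst k(2)[symmetric]) (intro Max_ge, auto)
  have "card (insert k S) = Suc r" using k(1) fin S(2) by simp
  then show ?case using S k(1) k_max by (intro exI[of _ "insert k S"]) auto
qed

lemma l2_norm_vmask_le_max:
  assumes "finite V" "card V \<le> n" "0 \<le> B" and B: "\<And>i. i \<in> V \<Longrightarrow> i < dim_vec z \<Longrightarrow> cmod (z $ i) \<le> B"
  shows "l2_norm (vmask V z) \<le> sqrt (real n) * B"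
proof -
  have "card (V \<inter> {..<dim_vec z}) \<le> n"
    using card_mono[OF \<open>finite V\<close>, of "V \<inter> {..<dim_vec z}"] \<open>card V \<le> n\<close> by simp
  then have card: "real (card (V \<inter> {..<dim_vec z})) \<le> real n" by simp
  have "(l2_norm (vmask V z))\<^sup>2 \<le> real (card (V \<inter> {..<dim_vec z})) * B\<^sup>2"
    unfolding l2_norm_vmask_sq
  proof (rule sum_bounded_above)
    show "(cmod (z $ i))\<^sup>2 \<le> B\<^sup>2" if "i \<in> V \<inter> {..<dim_vec z}" for i
      by (rule power_mono) (use B that in auto)
  qed
  also have "\<dots> \<le> real n * B\<^sup>2"
    using card by (rule mult_right_mono) simp
  also have "\<dots> = (sqrt (real n) * B)\<^sup>2" by (simp add: power_mult_distrib)
  finally show ?thesis by (rule power2_le_imp_le) (simp add: \<open>0 \<le> B\<close>)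
qed

text \<open>The blocks are peeled off in order of decreasing magnitude, so that the Euclidean norm of
  each block is at most \<open>1 / sqrt s\<close> times the \<open>l1\<close> norm of the preceding one.\<close>

lemma energy_bound_blocks:
  assumes A: "A \<in> carrier_mat m d" and "0 < s" "0 \<le> K"
    and K: "\<And>z. z \<in> carrier_vec d \<Longrightarrow> sparse s z \<Longrightarrow> l2_norm (A *\<^sub>v z) \<le> K * l2_norm z"
    and u: "u \<in> carrier_vec d"
    and B: "\<And>V. V \<subseteq> {..<d} \<Longrightarrow> card V \<le> s \<Longrightarrow> l2_norm (vmask V u) \<le> B"
  shows "l2_norm (A *\<^sub>v u) \<le> K * (B + l1_norm u / sqrt (real s))"
  using u B
\<comment> \<open>\<open>B\<close> is generalized because the remainder inherits a new bound on its
  blocks, derived from the block just removed.\<close>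
proof (induction "card (supp u)" arbitrary: u B rule: less_induct)
  case less
  note u = less.prems(1)
  show ?case
  proof (cases "sparse s u")
    case True
    have "l2_norm (A *\<^sub>v u) \<le> K * l2_norm u" using K u True by blast
    also have "l2_norm u \<le> B"
      using less.prems(2)[of "supp u"] True supp_subset_dim[of u] u by (simp add: sparse_def vmask_eq_self)
    then have "K * l2_norm u \<le> K * (B + l1_norm u / sqrt (real s))"
      using \<open>0 \<le> K\<close> by (intro mult_left_mono add_increasing2) auto
    finally show ?thesis .
  next
    case False
    then have big: "s < card (supp u)" by (simp add: sparse_def)
    have "card (supp u) \<le> d" using card_mono[OF _ supp_subset_dim[of u]] u by simp
    then obtain S where S: "S \<subseteq> {..<d}" "card S = s"
        "\<forall>i\<in>S. \<forall>j\<in>{..<d} - S. cmod (u $ j) \<le> cmod (u $ i)"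
      using exists_largest_set[of s d "\<lambda>i. cmod (u $ i)"] big by auto
    have fin: "finite S" using S(1) by (rule finite_nat_sets)
    have "\<not> supp u \<subseteq> S" using big S(2) card_mono[OF fin, of "supp u"] by auto
    then obtain j where "j \<in> supp u" "j \<notin> S" by blast
    then have j: "j \<in> {..<d} - S" "u $ j \<noteq> 0" using u by (auto simp: supp_def)
    \<comment> \<open>A nonzero entry lies outside \<open>S\<close> and is dominated by all entries
      on \<open>S\<close>; so removing \<open>S\<close> strictly shrinks the support.\<close>
    have "S \<subseteq> supp u"
    proof
      fix i assume i: "i \<in> S"
      then have "cmod (u $ j) \<le> cmod (u $ i)" using S(3) j(1) by blast
      then show "i \<in> supp u" using i S(1) u j(2) by (auto simp: supp_def)
    qed
    moreover have "S \<noteq> {}" using S(2) \<open>0 < s\<close> by auto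
    ultimately have "supp (vmask (- S) u) \<subset> supp u" by (auto simp: supp_vmask)
    then have card: "card (supp (vmask (- S) u)) < card (supp u)"
      by (intro psubset_card_mono) auto
    \<comment> \<open>The mean magnitude on the block \<open>S\<close>, which dominates every
      remaining entry.\<close>
    let ?B = "l1_norm (vmask S u) / real s"
    have small: "cmod (u $ k) \<le> ?B" if k: "k \<in> {..<d} - S" for k
    proof -
      have "real s * cmod (u $ k) = (\<Sum>i\<in>S. cmod (u $ k))" using S(2) by simp
      also have "\<dots> \<le> (\<Sum>i\<in>S. cmod (u $ i))" using S(3) k by (intro sum_mono) blast
      also have "\<dots> = l1_norm (vmask S u)"
        unfolding l1_norm_vmask using S(1) u by (intro sum.cong) auto
      finally show ?thesis using \<open>0 < s\<close> by (simp add: field_simps)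
    qed
    have "l2_norm (A *\<^sub>v vmask (- S) u) \<le> K * (sqrt (real s) * ?B + l1_norm (vmask (- S) u) / sqrt (real s))"
    proof (rule less.hyps[OF card])
      fix V :: "nat set" assume V: "V \<subseteq> {..<d}" "card V \<le> s"
      show "l2_norm (vmask V (vmask (- S) u)) \<le> sqrt (real s) * ?B"
        using V small u finite_nat_sets[OF V(1)] by (intro l2_norm_vmask_le_max) auto
    qed (use u in simp)
    \<comment> \<open>With this the block \<open>S\<close> supplies exactly its share of the
      \<open>l1\<close> norm, and the sum telescopes to \<open>l1_norm u\<close>.\<close>
    also have "sqrt (real s) * ?B = l1_norm (vmask S u) / sqrt (real s)"
      using \<open>0 < s\<close> by (simp add: field_simps flip: power2_eq_square)
    finally have tail: "l2_norm (A *\<^sub>v vmask (- S) u) \<le> K * (l1_norm u / sqrt (real s))"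
      by (simp add: l1_norm_split[of u S] add_divide_distrib)
    have "l2_norm (A *\<^sub>v vmask S u) \<le> K * l2_norm (vmask S u)"
      using u S fin by (intro K sparse_subset[of _ S]) (auto simp: supp_vmask)
    also have "\<dots> \<le> K * B"
      using less.prems(2)[of S] S \<open>0 \<le> K\<close> by (intro mult_left_mono) auto
    finally have head: "l2_norm (A *\<^sub>v vmask S u) \<le> K * B" .
    have "u = vmask S u + vmask (- S) u" by auto
    then have "A *\<^sub>v u = A *\<^sub>v vmask S u + A *\<^sub>v vmask (- S) u"
      using mult_add_distrib_mat_vec[OF A, of "vmask S u" "vmask (- S) u"] u by simp
    then have "l2_norm (A *\<^sub>v u) \<le> l2_norm (A *\<^sub>v vmask S u) + l2_norm (A *\<^sub>v vmask (- S) u)"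
      using l2_norm_triangle[of "A *\<^sub>v vmask S u" m "A *\<^sub>v vmask (- S) u"] A u by simp
    then show ?thesis using head tail by (simp add: algebra_simps)
  qed
qed

text \<open>Extends the upper half of the isometry property to vectors that are not sparse; it is
  applied to the tail \<open>x - xs\<close>, for both \<open>A\<close> and
  \<open>\<Phi>\<close>.\<close>

lemma energy_bound:
  assumes A: "A \<in> carrier_mat m d" and rip: "rip A s \<delta>" and "0 < s" "0 \<le> \<delta>"
    and u: "u \<in> carrier_vec d"
  shows "l2_norm (A *\<^sub>v u) \<le> sqrt (1 + \<delta>) * (l2_norm u + l1_norm u / sqrt (real s))"
proof (rule energy_bound_blocks[OF A \<open>0 < s\<close> _ _ u])
  show "l2_norm (A *\<^sub>v z) \<le> sqrt (1 + \<delta>) * l2_norm z" if "z \<in> carrier_vec d" "sparse s z" for z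
    using that by (rule rip_upper[OF A rip])
  show "l2_norm (vmask V u) \<le> l2_norm u" for V
    by (rule l2_norm_vmask_le)
qed (use \<open>0 \<le> \<delta>\<close> in simp)

section \<open>One iteration of CoSaMP\<close>

lemma add_minus_vec_swap:
  fixes u v e :: "complex vec"
  assumes "u \<in> carrier_vec n" "v \<in> carrier_vec n" "e \<in> carrier_vec n"
  shows "u + e - v = u - v + e"
  using assms by auto

lemma minus_add_vec_swap:
  fixes u v e :: "complex vec"
  assumes "u \<in> carrier_vec n" "v \<in> carrier_vec n" "e \<in> carrier_vec n"
  shows "v - (u + e) = - (u - v + e)"
  using assms by auto

text \<open>On \<open>supp p \<union> supp r\<close>, of at most 4s indices, the proxy differs from
  \<open>r\<close> by a Gram residual and adjoint noise. What the selection misses is dominated in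
  the proxy by what it wrongly takes, where \<open>r\<close> vanishes; both parts are deviations,
  hence the factor 2.\<close>

lemma identification:
  assumes M: "M \<in> carrier_mat m d" and rip: "rip M (4 * s) \<delta>" and \<delta>: "0 < \<delta>"
    and r: "r \<in> carrier_vec d" "sparse (2 * s) r" and e: "e \<in> carrier_vec m"
    and p: "largest_part (2 * s) (mat_adjoint M *\<^sub>v (M *\<^sub>v r + e)) p"
  shows "l2_norm (vmask (- supp p) r) \<le> 2 * \<delta> * l2_norm r + 2 * sqrt (1 + \<delta>) * l2_norm e"
proof -
  define u where "u = mat_adjoint M *\<^sub>v (M *\<^sub>v r + e)"
  have M': "mat_adjoint M \<in> carrier_mat d m" using M by simp
  have Mr: "M *\<^sub>v r \<in> carrier_vec m" using M r by simp
  have MMr: "mat_adjoint M *\<^sub>v (M *\<^sub>v r) \<in> carrier_vec d" using mult_mat_vec_carrier[OF M' Mr] .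
  have Me: "mat_adjoint M *\<^sub>v e \<in> carrier_vec d" using mult_mat_vec_carrier[OF M' e] .
  have u: "u \<in> carrier_vec d"
    unfolding u_def using mult_mat_vec_carrier[OF M'] Mr e by simp
  obtain S where S: "S \<subseteq> {..<d}" "card S = min (2 * s) d"
      "\<forall>i\<in>S. \<forall>j\<in>{..<d} - S. cmod (u $ j) \<le> cmod (u $ i)" "p = vmask S u"
    using largest_partE[OF p[folded u_def] u] .
  define R where "R = supp r"
  have R: "R \<subseteq> {..<d}" "card R \<le> 2 * s" "finite R"
    using r supp_subset_dim[of r] by (auto simp: R_def sparse_def)
  have sp: "supp p = S \<inter> supp u" by (simp add: S(4) supp_vmask)
  have p_card: "card (supp p) \<le> 2 * s"
    using largest_part_sparse[OF p[folded u_def] u] by (simp add: sparse_def)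
  have dev: "l2_norm (vmask V (u - r)) \<le> \<delta> * l2_norm r + sqrt (1 + \<delta>) * l2_norm e"
    if V: "V \<subseteq> supp p \<union> R" for V
  proof -
    have fin: "finite (supp p \<union> R)" using R by simp
    have "card (V \<union> R) \<le> card (supp p \<union> R)" "card V \<le> card (supp p \<union> R)"
      using V fin by (auto intro!: card_mono)
    moreover have "card (supp p \<union> R) \<le> 4 * s"
      using card_Un_le[of "supp p" R] p_card R(2) by linarith
    ultimately have V_card: "card (V \<union> supp r) \<le> 4 * s" "card V \<le> 4 * s" "finite V"
      using finite_subset[OF V fin] by (auto simp: R_def)
    have "u = mat_adjoint M *\<^sub>v (M *\<^sub>v r) + mat_adjoint M *\<^sub>v e"
      unfolding u_def by (rule mult_add_distrib_mat_vec[OF M' Mr e])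
    then have "u - r = (mat_adjoint M *\<^sub>v (M *\<^sub>v r) - r) + mat_adjoint M *\<^sub>v e"
      by (simp only: add_minus_vec_swap[OF MMr r(1) Me])
    then have "vmask V (u - r)
        = vmask V (mat_adjoint M *\<^sub>v (M *\<^sub>v r) - r) + vmask V (mat_adjoint M *\<^sub>v e)"
      using vmask_add[of "mat_adjoint M *\<^sub>v (M *\<^sub>v r) - r" d "mat_adjoint M *\<^sub>v e" V] MMr Me r by simp
    then have "l2_norm (vmask V (u - r)) \<le> l2_norm (vmask V (mat_adjoint M *\<^sub>v (M *\<^sub>v r) - r))
        + l2_norm (vmask V (mat_adjoint M *\<^sub>v e))"
      using l2_norm_triangle[of "vmask V (mat_adjoint M *\<^sub>v (M *\<^sub>v r) - r)" d "vmask V (mat_adjoint M *\<^sub>v e)"]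
        MMr Me r by simp
    then show ?thesis
      using rip_gram_residual[OF M rip \<delta> r(1) V_card(3,1)] rip_adjoint[OF M rip _ e V_card(3,2)] \<delta>
      by linarith
  qed
  let ?V = "R - supp p" and ?W = "supp p - R"
  have "vmask (- supp p) r = vmask ?V r"
    by (rule eq_vecI) (auto simp: R_def supp_def)
  also have "\<dots> = vmask ?V u - vmask ?V (u - r)"
    using u r by (intro eq_vecI) auto
  finally have "l2_norm (vmask (- supp p) r) \<le> l2_norm (vmask ?V u) + l2_norm (vmask ?V (u - r))"
    using l2_norm_diff_triangle[of "vmask ?V u" d "vmask ?V (u - r)"] u r by simp
  \<comment> \<open>\<open>supp p\<close> can be smaller than the selected set \<open>S\<close>, but
    only by indices at which the proxy is zero.\<close>
  moreover have "l2_norm (vmask ?V u) \<le> l2_norm (vmask (R - S) u)"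
    by (rule l2_norm_vmask_mono) (auto simp: sp)
  moreover have "l2_norm (vmask (R - S) u) \<le> l2_norm (vmask (S - R) u)"
    by (rule largest_swap[OF u S(1-3) R(1,2)])
  moreover have "l2_norm (vmask (S - R) u) \<le> l2_norm (vmask ?W u)"
    by (rule l2_norm_vmask_mono) (auto simp: sp)
  moreover have "vmask ?W u = vmask ?W (u - r)"
    using u r by (intro eq_vecI) (auto simp: R_def supp_def)
  ultimately have "l2_norm (vmask (- supp p) r) \<le> l2_norm (vmask ?W (u - r)) + l2_norm (vmask ?V (u - r))"
    by simp
  moreover have "?V \<subseteq> supp p \<union> R" "?W \<subseteq> supp p \<union> R" by auto
  note dev[OF this(1)] dev[OF this(2)]
  ultimately show ?thesis by (simp add: algebra_simps)
qed

lemma mult_uminus_mat_vec: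
  assumes "(A :: complex mat) \<in> carrier_mat n k" "v \<in> carrier_vec k"
  shows "A *\<^sub>v (- v) = - (A *\<^sub>v v)"
proof -
  have "- v = (- 1) \<cdot>\<^sub>v v" "- (A *\<^sub>v v) = (- 1) \<cdot>\<^sub>v (A *\<^sub>v v)" by auto
  then show ?thesis using mult_mat_vec[OF assms, of "- 1"] by simp
qed

text \<open>On \<open>T\<close> the normal equations express the error \<open>z\<close> through its
  own Gram residual and adjoint noise, so that \<open>\<delta> * l2_norm z\<close> can be absorbed
  on the left. Off \<open>T\<close>, \<open>w\<close> vanishes and the error is \<open>x\<close>
  itself.\<close>

lemma estimation:
  assumes M: "M \<in> carrier_mat m d" and rip: "rip M (4 * s) \<delta>" and \<delta>: "0 < \<delta>" "\<delta> < 1"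
    and x: "x \<in> carrier_vec d" "sparse s x" and e: "e \<in> carrier_vec m"
    and T: "T \<subseteq> {..<d}" "card T \<le> 3 * s"
    and w: "w \<in> carrier_vec d" "supp w \<subseteq> T"
      "vec_restrict w T = pseudoinverse (col_submatrix M T) *\<^sub>v (M *\<^sub>v x + e)"
  shows "(1 - \<delta>) * l2_norm (x - w) \<le> l2_norm (vmask (- T) x) + sqrt (1 + \<delta>) * l2_norm e"
proof -
  define z where "z = x - w"
  have z: "z \<in> carrier_vec d" using x w by (simp add: z_def)
  have fin: "finite T" using T(1) by (rule finite_nat_sets)
  have M': "mat_adjoint M \<in> carrier_mat d m" using M by simp
  have Mz: "M *\<^sub>v z \<in> carrier_vec m" using M z by simp
  have MMz: "mat_adjoint M *\<^sub>v (M *\<^sub>v z) \<in> carrier_vec d" using mult_mat_vec_carrier[OF M' Mz] .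
  have Me: "mat_adjoint M *\<^sub>v e \<in> carrier_vec d" using mult_mat_vec_carrier[OF M' e] .
  have Mx: "M *\<^sub>v x \<in> carrier_vec m" and Mw: "M *\<^sub>v w \<in> carrier_vec m" using M x w by simp_all
  have inj: "v = 0\<^sub>v d" if v: "v \<in> carrier_vec d" "supp v \<subseteq> T" "M *\<^sub>v v = 0\<^sub>v m" for v
  proof -
    have "sparse (4 * s) v" using v(2) fin T by (intro sparse_subset[of _ T]) auto
    then have "sqrt (1 - \<delta>) * l2_norm v \<le> 0" using rip_lower[OF M rip v(1)] v(3) by simp
    then have "l2_norm v = 0" using \<delta> l2_norm_nonneg[of v] by (simp add: mult_le_0_iff)
    then show ?thesis using l2_norm_eq_0_iff[OF v(1)] by simp
  qed
  have "vmask T (mat_adjoint M *\<^sub>v (M *\<^sub>v w - (M *\<^sub>v x + e))) = 0\<^sub>v d"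
    using Mx e by (intro least_squares_normal_equations[OF M T(1) inj w(1,2) _ w(3)]) auto
  moreover have "M *\<^sub>v w - (M *\<^sub>v x + e) = - (M *\<^sub>v z + e)"
    unfolding z_def mult_minus_distrib_mat_vec[OF M x(1) w(1)] by (rule minus_add_vec_swap[OF Mx Mw e])
  moreover have "mat_adjoint M *\<^sub>v (- (M *\<^sub>v z + e)) = - (mat_adjoint M *\<^sub>v (M *\<^sub>v z) + mat_adjoint M *\<^sub>v e)"
    using mult_uminus_mat_vec[OF M', of "M *\<^sub>v z + e"] mult_add_distrib_mat_vec[OF M' Mz e] Mz e
    by simp
  ultimately have normal: "vmask T (- (mat_adjoint M *\<^sub>v (M *\<^sub>v z) + mat_adjoint M *\<^sub>v e)) = 0\<^sub>v d"
    by simp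
  have "vmask T z = - vmask T (mat_adjoint M *\<^sub>v (M *\<^sub>v z) - z) - vmask T (mat_adjoint M *\<^sub>v e)"
  proof (rule eq_vecI)
    fix i assume "i < dim_vec (- vmask T (mat_adjoint M *\<^sub>v (M *\<^sub>v z) - z) - vmask T (mat_adjoint M *\<^sub>v e))"
    then have i: "i < d" using M by simp
    have "vmask T (- (mat_adjoint M *\<^sub>v (M *\<^sub>v z) + mat_adjoint M *\<^sub>v e)) $ i = 0"
      using normal i by simp
    then show "vmask T z $ i = (- vmask T (mat_adjoint M *\<^sub>v (M *\<^sub>v z) - z) - vmask T (mat_adjoint M *\<^sub>v e)) $ i"
      using i z MMz Me M by (auto simp del: index_mult_mat_vec split: if_splits simp: add_eq_0_iff)
  qed (use z M in simp)
  then have "l2_norm (vmask T z) \<le> l2_norm (vmask T (mat_adjoint M *\<^sub>v (M *\<^sub>v z) - z))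
      + l2_norm (vmask T (mat_adjoint M *\<^sub>v e))"
    using l2_norm_diff_triangle[of "- vmask T (mat_adjoint M *\<^sub>v (M *\<^sub>v z) - z)" d "vmask T (mat_adjoint M *\<^sub>v e)"]
      MMz Me z by simp
  also have "\<dots> \<le> \<delta> * l2_norm z + sqrt (1 + \<delta>) * l2_norm e"
  proof -
    \<comment> \<open>At most 3s indices from \<open>T\<close> and s from \<open>x\<close>, which is
      where the order 4s is used up.\<close>
    have "T \<union> supp z \<subseteq> T \<union> supp x" using supp_diff[OF x(1) w(1)] w(2) by (auto simp: z_def)
    then have "card (T \<union> supp z) \<le> card (T \<union> supp x)" using fin by (intro card_mono) auto
    also have "\<dots> \<le> 4 * s" using card_Un_le[of T "supp x"] T(2) x(2) by (simp add: sparse_def)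
    finally show ?thesis
      using rip_gram_residual[OF M rip \<delta>(1) z fin] rip_adjoint[OF M rip _ e fin] T \<delta>
      by (intro add_mono) auto
  qed
  finally have "l2_norm (vmask T z) \<le> \<delta> * l2_norm z + sqrt (1 + \<delta>) * l2_norm e" .
  moreover have "vmask (- T) z = vmask (- T) x"
    using x w by (intro eq_vecI) (auto simp: z_def supp_def)
  moreover have "z = vmask T z + vmask (- T) z" by auto
  then have "l2_norm z \<le> l2_norm (vmask T z) + l2_norm (vmask (- T) z)"
    using l2_norm_triangle[of "vmask T z" d "vmask (- T) z"] z by simp
  ultimately show ?thesis by (simp add: z_def algebra_simps)
qed

lemma supp_subset_if:
  "w \<in> carrier_vec d \<Longrightarrow> (\<forall>i<d. i \<notin> T \<longrightarrow> w $ i = 0) \<Longrightarrow> supp w \<subseteq> T"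
  by (auto simp: supp_def)

lemma sqrt_11_10: "sqrt (1 + 1 / 10) \<le> 21 / 20"
  by (rule real_le_lsqrt) (simp_all add: power2_eq_square)

text \<open>Eliminating \<open>z\<close> and \<open>t\<close> gives the factor 2 * (1/5) / (9/10) =
  4/9 on \<open>r\<close> and 2 * (21/10 + 21/20) / (9/10) = 7 on \<open>e\<close>.\<close>

lemma contraction_arith:
  fixes n e r t v z :: real
  assumes "(1 - 1 / 10) * z \<le> t + n" "v \<le> 2 * z" "n \<le> 21 / 20 * e"
    "t \<le> 1 / 5 * r + 21 / 10 * e" "0 \<le> r"
  shows "v \<le> 1 / 2 * r + 7 * e"
proof -
  have "(1 - 1 / 10) * z = 9 / 10 * z" by simp
  then show ?thesis using assms by linarith
qed

text \<open>The residual has the fixed form \<open>M *\<^sub>v x + e - M *\<^sub>v a\<close>, an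
  invariant of the run. The last claim rests on estimation alone: if \<open>T\<close> contains the
  support and there is no noise, least squares is exact and pruning keeps \<open>x\<close>.\<close>

lemma cosamp_step_error:
  assumes M: "M \<in> carrier_mat m d" and rip: "rip M (4 * s) (1 / 10)"
    and x: "x \<in> carrier_vec d" "sparse s x" and e: "e \<in> carrier_vec m"
    and a: "a \<in> carrier_vec d" "sparse s a"
    and step: "cosamp_step M (M *\<^sub>v x + e) s a (M *\<^sub>v x + e - M *\<^sub>v a) a' v'"
  shows "a' \<in> carrier_vec d" "sparse s a'" "v' = M *\<^sub>v x + e - M *\<^sub>v a'"
    and "l2_norm (x - a') \<le> 1 / 2 * l2_norm (x - a) + 7 * l2_norm e"
    and "supp x \<subseteq> supp a \<Longrightarrow> l2_norm e = 0 \<Longrightarrow> a' = x"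
proof -
  let ?y = "M *\<^sub>v x + e"
  have dimM: "dim_col M = d" using M by simp
  obtain p w T where p: "largest_part (2 * s) (mat_adjoint M *\<^sub>v (?y - M *\<^sub>v a)) p"
    and T: "T = supp p \<union> supp a" and w: "w \<in> carrier_vec d"
    and ls: "vec_restrict w T = pseudoinverse (col_submatrix M T) *\<^sub>v ?y"
    and w0: "\<forall>i<d. i \<notin> T \<longrightarrow> w $ i = 0" and a': "largest_part s w a'" and v': "v' = ?y - M *\<^sub>v a'"
    using step unfolding cosamp_step_def dimM by blast
  show ca': "a' \<in> carrier_vec d" and "sparse s a'"
    using largest_part_carrier[OF a' w] largest_part_sparse[OF a' w] .
  show "v' = ?y - M *\<^sub>v a'" by (rule v')
  have M': "mat_adjoint M \<in> carrier_mat d m" using M by simp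
  have Mx: "M *\<^sub>v x \<in> carrier_vec m" and Ma: "M *\<^sub>v a \<in> carrier_vec m" using M x a by simp_all
  have r: "x - a \<in> carrier_vec d" using x a by simp
  have "card (supp (x - a)) \<le> card (supp x \<union> supp a)"
    using supp_diff[OF x(1) a(1)] by (intro card_mono) auto
  then have r_sparse: "sparse (2 * s) (x - a)"
    using card_Un_le[of "supp x" "supp a"] x(2) a(2) by (simp add: sparse_def)
  \<comment> \<open>The residual is a noisy measurement of the current error, which is the sparse
    vector that identification tries to locate.\<close>
  have "?y - M *\<^sub>v a = M *\<^sub>v (x - a) + e"
    unfolding mult_minus_distrib_mat_vec[OF M x(1) a(1)] by (rule add_minus_vec_swap[OF Mx Ma e])
  then have p': "largest_part (2 * s) (mat_adjoint M *\<^sub>v (M *\<^sub>v (x - a) + e)) p"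
    using p by simp
  have pc: "mat_adjoint M *\<^sub>v (M *\<^sub>v (x - a) + e) \<in> carrier_vec d"
    using M r e by (intro mult_mat_vec_carrier[OF M']) simp
  have "p \<in> carrier_vec d" "sparse (2 * s) p"
    using largest_part_carrier[OF p' pc] largest_part_sparse[OF p' pc] .
  then have Td: "T \<subseteq> {..<d}" and Tc: "card T \<le> 3 * s"
    using supp_subset_dim[of p] supp_subset_dim[of a] a card_Un_le[of "supp p" "supp a"]
    by (auto simp: T sparse_def)
  have est: "(1 - 1 / 10) * l2_norm (x - w) \<le> l2_norm (vmask (- T) x) + sqrt (1 + 1 / 10) * l2_norm e"
    by (rule estimation[OF M rip _ _ x e Td Tc w supp_subset_if[OF w w0] ls]) auto
  have prune: "l2_norm (x - a') \<le> 2 * l2_norm (x - w)"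
    by (rule largest_part_error[OF a' w x])
  have noise: "sqrt (1 + 1 / 10) * l2_norm e \<le> 21 / 20 * l2_norm e"
    by (rule mult_right_mono[OF sqrt_11_10]) simp
  \<comment> \<open>\<open>T\<close> contains the support of \<open>a\<close>, so off
    \<open>T\<close> the signal and the current error coincide.\<close>
  have "vmask (- T) x = vmask (- T) (x - a)"
    using x a by (intro eq_vecI) (auto simp: T supp_def)
  then have "l2_norm (vmask (- T) x) \<le> l2_norm (vmask (- supp p) (x - a))"
    using l2_norm_vmask_mono[of "- T" "x - a" "- supp p"] by (auto simp: T)
  also have "\<dots> \<le> 2 * (1 / 10) * l2_norm (x - a) + 2 * sqrt (1 + 1 / 10) * l2_norm e"
    by (rule identification[OF M rip _ r r_sparse e p']) simp
  finally have "l2_norm (vmask (- T) x) \<le> 1 / 5 * l2_norm (x - a) + 21 / 10 * l2_norm e"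
    using noise by simp
  then show "l2_norm (x - a') \<le> 1 / 2 * l2_norm (x - a) + 7 * l2_norm e"
    by (rule contraction_arith[OF est prune noise _ l2_norm_nonneg])
  assume "supp x \<subseteq> supp a" "l2_norm e = 0"
  then have "vmask (- T) x = 0\<^sub>v d" using x by (intro vmask_eq_0) (auto simp: T)
  then have "l2_norm (x - a') \<le> 0" using est prune \<open>l2_norm e = 0\<close> by simp
  then have "x - a' = 0\<^sub>v d"
    using l2_norm_eq_0_iff[of "x - a'" d] x ca' l2_norm_nonneg[of "x - a'"] by auto
  show "a' = x"
  proof (rule eq_vecI)
    fix i assume "i < dim_vec x"
    then have i: "i < d" using x by simp
    then have "(x - a') $ i = 0" using \<open>x - a' = 0\<^sub>v d\<close> by simp
    then show "a' $ i = x $ i" using i x ca' by simp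
  qed (use x ca' in simp)
qed

section \<open>Convergence of CoSaMP\<close>

lemma cosamp_run_step:
  assumes M: "M \<in> carrier_mat m d" and rip: "rip M (4 * s) (1 / 10)"
    and x: "x \<in> carrier_vec d" "sparse s x" and e: "e \<in> carrier_vec m"
    and run: "cosamp_run M (M *\<^sub>v x + e) s a"
  shows "a k \<in> carrier_vec d"
    and "l2_norm (x - a (Suc k)) \<le> 1 / 2 * l2_norm (x - a k) + 7 * l2_norm e"
    and "supp x \<subseteq> supp (a k) \<Longrightarrow> l2_norm e = 0 \<Longrightarrow> a (Suc k) = x"
proof -
  let ?y = "M *\<^sub>v x + e"
  obtain v where a0: "a 0 = 0\<^sub>v d" and v0: "v 0 = ?y"
    and step: "\<And>k. cosamp_step M ?y s (a k) (v k) (a (Suc k)) (v (Suc k))"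
    using run M unfolding cosamp_run_def by auto
  note * = cosamp_step_error[OF M rip x e]
  have inv: "a k \<in> carrier_vec d \<and> sparse s (a k) \<and> v k = ?y - M *\<^sub>v a k" for k
  proof (induction k)
    case 0
    have "supp (0\<^sub>v d) = {}" by (auto simp: supp_def)
    moreover have "?y - 0\<^sub>v m = ?y" using M x e by auto
    ultimately show ?case using M a0 v0 by (auto simp: sparse_def mult_mat_vec_zero)
  next
    case (Suc k)
    then show ?case using *(1-3)[of "a k" "a (Suc k)" "v (Suc k)"] step[of k] by auto
  qed
  then show "a k \<in> carrier_vec d" by simp
  show "l2_norm (x - a (Suc k)) \<le> 1 / 2 * l2_norm (x - a k) + 7 * l2_norm e"
    using inv[of k] *(4)[of "a k" "a (Suc k)" "v (Suc k)"] step[of k] by auto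
  show "supp x \<subseteq> supp (a k) \<Longrightarrow> l2_norm e = 0 \<Longrightarrow> a (Suc k) = x"
    using inv[of k] *(5)[of "a k" "a (Suc k)" "v (Suc k)"] step[of k] by auto
qed

text \<open>14 is the fixed point of \<open>t / 2 + 7\<close>.\<close>

lemma cosamp_error:
  assumes M: "M \<in> carrier_mat m d" and rip: "rip M (4 * s) (1 / 10)"
    and x: "x \<in> carrier_vec d" "sparse s x" and e: "e \<in> carrier_vec m"
    and run: "cosamp_run M (M *\<^sub>v x + e) s a"
  shows "l2_norm (x - a k) \<le> (1 / 2) ^ k * l2_norm x + 14 * l2_norm e"
proof (induction k)
  case 0
  have "a 0 = 0\<^sub>v d" using run M by (auto simp: cosamp_run_def)
  then show ?case using x by simp
next
  case (Suc k)
  then show ?case using cosamp_run_step(2)[OF assms, of k] by simp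
qed

lemma half_power_eventually_less:
  fixes c \<nu> :: real
  assumes "0 < \<nu>"
  shows "\<exists>K. \<forall>k\<ge>K. (1 / 2) ^ k * c < \<nu>"
proof -
  have "(\<lambda>k. (1 / 2) ^ k * c) \<longlonglongrightarrow> 0 * c"
    by (intro tendsto_mult tendsto_const LIMSEQ_power_zero) simp
  then have "\<forall>\<^sub>F k in sequentially. (1 / 2) ^ k * c < \<nu>"
    using assms by (intro order_tendstoD(2)) auto
  then show ?thesis by (simp add: eventually_sequentially)
qed

text \<open>An iterate missing an index of the support has an error of at least the smallest nonzero
  magnitude of \<open>x\<close>; the error eventually falls below that.\<close>

lemma cosamp_exact_recovery:
  assumes M: "M \<in> carrier_mat m d" and rip: "rip M (4 * s) (1 / 10)"
    and x: "x \<in> carrier_vec d" "sparse s x"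
    and e: "e \<in> carrier_vec m" "l2_norm e = 0"
    and run: "cosamp_run M (M *\<^sub>v x + e) s a"
  shows "\<exists>K. \<forall>k\<ge>K. a k = x"
proof -
  note run_facts = cosamp_run_step[OF M rip x e(1) run]
  \<comment> \<open>The 1 keeps the minimum meaningful and positive when the support is
    empty.\<close>
  define \<mu> where "\<mu> = Min (insert 1 ((\<lambda>i. cmod (x $ i)) ` supp x))"
  have \<mu>: "0 < \<mu>" "\<And>i. i \<in> supp x \<Longrightarrow> \<mu> \<le> cmod (x $ i)"
    by (auto simp: \<mu>_def) (auto simp: supp_def)
  obtain K where K: "\<And>k. k \<ge> K \<Longrightarrow> (1 / 2) ^ k * l2_norm x < \<mu>"
    using half_power_eventually_less[OF \<mu>(1)] by blast
  have "a (Suc k) = x" if k: "k \<ge> K" for k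
  proof (rule run_facts(3)[OF _ e(2)])
    have small: "l2_norm (x - a k) < \<mu>"
      using cosamp_error[OF M rip x e(1) run, of k] K[OF k] e(2) by simp
    show "supp x \<subseteq> supp (a k)"
    proof
      fix i assume i: "i \<in> supp x"
      then have id: "i < d" using x by (simp add: supp_def)
      have "a k $ i \<noteq> 0"
      proof
        assume "a k $ i = 0"
        then have "cmod (x $ i) = cmod ((x - a k) $ i)" using id x run_facts(1)[of k] by simp
        also have "\<dots> \<le> l2_norm (x - a k)" using id x run_facts(1)[of k] by (intro cmod_le_l2_norm) simp
        finally show False using small \<mu>(2)[OF i] by simp
      qed
      then show "i \<in> supp (a k)" using id run_facts(1)[of k] by (simp add: supp_def)
    qed
  qed
  \<comment> \<open>Iterate \<open>k\<close> contains the support, and only its successor is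
    exact.\<close>
  then have "\<forall>k\<ge>Suc K. a k = x" by (metis Suc_le_D Suc_le_mono)
  then show ?thesis by blast
qed


section \<open>Perturbation of the decoding matrix\<close>

lemma minus_diff_vec_cancel:
  "(u :: complex vec) \<in> carrier_vec n \<Longrightarrow> v \<in> carrier_vec n \<Longrightarrow> u - (u - v) = v"
  by auto

lemma add_diff_vec_cancel:
  "(u :: complex vec) \<in> carrier_vec n \<Longrightarrow> v \<in> carrier_vec n \<Longrightarrow> v + (u - v) = u"
  by auto

lemma measurement_split:
  fixes p q r e :: "complex vec"
  assumes "p \<in> carrier_vec n" "q \<in> carrier_vec n" "r \<in> carrier_vec n" "e \<in> carrier_vec n"
  shows "p + e = r + (p - q + (q - r) + e)"
  using assms by auto

text \<open>With \<open>q\<close> and \<open>p\<close> the square roots of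
  \<open>1 + \<delta>\<close> and \<open>1 - \<delta>\<close>, the factors for \<open>\<Phi>\<close>
  are \<open>q * (1 + E)\<close> and \<open>p - q * E\<close>. The hypothesis bounds the square of
  the first by 1.1. As \<open>p \<le> q\<close>, the two squares add up to at least
  \<open>p\<^sup>2 + q\<^sup>2 = 2\<close>, so the second is at least 0.9.\<close>

lemma rip_perturbed:
  assumes A: "A \<in> carrier_mat m d" and \<Phi>: "\<Phi> \<in> carrier_mat m d" and "0 < d" "0 < n"
    and ric: "ric A n \<le> 1.1 / (1 + rel_perturbation A \<Phi> n)\<^sup>2 - 1"
  shows "rip \<Phi> n (1 / 10)"
proof -
  define \<delta> where "\<delta> = ric A n"
  define E where "E = rel_perturbation A \<Phi> n"
  define q where "q = sqrt (1 + \<delta>)"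
  define p where "p = sqrt (1 - \<delta>)"
  have rip: "rip A n \<delta>" unfolding \<delta>_def by (rule rip_ric[OF A \<open>0 < d\<close> \<open>0 < n\<close>])
  have \<delta>0: "0 \<le> \<delta>" by (rule rip_nonneg[OF A rip \<open>0 < d\<close> \<open>0 < n\<close>])
  have E0: "0 \<le> E"
    unfolding E_def rel_perturbation_def by (intro divide_nonneg_nonneg spectral_norm_cols_nonneg)
  have "1 \<le> (1 + E)\<^sup>2" using E0 by simp
  then have "(1 + \<delta>) * (1 + E)\<^sup>2 \<le> 1.1"
  proof (subst pos_le_divide_eq[symmetric])
    show "1 + \<delta> \<le> 1.1 / (1 + E)\<^sup>2"
      using ric unfolding \<delta>_def E_def by linarith
  qed (use E0 in simp)
  then have qE: "(q * (1 + E))\<^sup>2 \<le> 1.1"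
    using \<delta>0 by (simp add: q_def power_mult_distrib)
  have "(1 + \<delta>) * 1 \<le> (1 + \<delta>) * (1 + E)\<^sup>2"
    using \<delta>0 \<open>1 \<le> (1 + E)\<^sup>2\<close> by (intro mult_left_mono) auto
  then have \<delta>1: "\<delta> \<le> 0.1" using \<open>(1 + \<delta>) * (1 + E)\<^sup>2 \<le> 1.1\<close> by simp
  have q1: "1 \<le> q" using \<delta>0 by (simp add: q_def)
  have p0: "0.9 \<le> p" unfolding p_def using \<delta>1 by (intro real_le_rsqrt) (simp add: power2_eq_square)
  have pq: "p \<le> q" unfolding p_def q_def using \<delta>0 by simp
  have sum_sq: "p\<^sup>2 + q\<^sup>2 = 2" using \<delta>0 \<delta>1 by (simp add: p_def q_def)
  have "(q * (1 + E))\<^sup>2 \<le> 1.05\<^sup>2" using qE by (simp add: power2_eq_square)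
  then have "q * (1 + E) \<le> 1.05" by (rule power2_le_imp_le) simp
  \<comment> \<open>Needed to square the lower bound: \<open>q * E\<close> is at most 0.05, since
    \<open>q\<close> is at least 1.\<close>
  then have diff0: "0 \<le> p - q * E" using q1 p0 by (simp add: algebra_simps)
  have "0 \<le> q * E * (q - p)" using q1 E0 pq by simp
  moreover have "(p - q * E)\<^sup>2 + (q * (1 + E))\<^sup>2 = (p\<^sup>2 + q\<^sup>2) + 2 * (q * E * (q - p)) + 2 * (q * E)\<^sup>2"
    by (simp add: power2_eq_square algebra_simps)
  moreover have "0 \<le> (q * E)\<^sup>2" by simp
  ultimately have diff: "0.9 \<le> (p - q * E)\<^sup>2" using qE sum_sq by linarith
  have A\<Phi>: "A - \<Phi> \<in> carrier_mat m d" using \<Phi> by (rule minus_carrier_mat)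
  let ?N = "spectral_norm_cols n A"
  have N_le: "?N \<le> q"
    unfolding q_def using \<delta>0 rip_upper[OF A rip] by (intro spectral_norm_cols_le[OF A]) auto
  \<comment> \<open>The ratio \<open>E\<close> controls the perturbation only if its denominator is
    nonzero; the lower isometry bound at a unit vector ensures that.\<close>
  have N_pos: "0 < ?N"
  proof -
    let ?z = "unit_vec d 0 :: complex vec"
    have z: "?z \<in> carrier_vec d" by simp
    have "supp ?z = {0}" using \<open>0 < d\<close> by (auto simp: supp_def unit_vec_def split: if_splits)
    then have sp: "sparse n ?z" using \<open>0 < n\<close> by (simp add: sparse_def)
    have "?z \<noteq> 0\<^sub>v d" using \<open>0 < d\<close> by (metis index_unit_vec(1) index_zero_vec(1) zero_neq_one)
    then have pos: "0 < l2_norm ?z"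
      using l2_norm_eq_0_iff[OF z] l2_norm_nonneg[of ?z] by linarith
    have "p * l2_norm ?z \<le> ?N * l2_norm ?z"
      using rip_lower[OF A rip z sp] spectral_norm_cols_bound[OF A z sp] by (simp add: p_def)
    then have "p \<le> ?N" using pos by simp
    then show ?thesis using p0 by simp
  qed
  have "spectral_norm_cols n (A - \<Phi>) = E * ?N"
    using N_pos by (simp add: E_def rel_perturbation_def)
  also have "\<dots> \<le> q * E" using N_le E0 by (simp add: mult.commute mult_left_mono)
  finally have pert: "spectral_norm_cols n (A - \<Phi>) \<le> q * E" .
  show ?thesis
    unfolding rip_def
  proof (intro ballI impI conjI)
    fix z :: "complex vec" assume "z \<in> carrier_vec (dim_col \<Phi>)" and sp: "sparse n z"
    then have z: "z \<in> carrier_vec d" using \<Phi> by simp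
    have Az: "A *\<^sub>v z \<in> carrier_vec m" and \<Phi>z: "\<Phi> *\<^sub>v z \<in> carrier_vec m" using A \<Phi> z by simp_all
    have Dz: "(A - \<Phi>) *\<^sub>v z \<in> carrier_vec m" using mult_mat_vec_carrier[OF A\<Phi> z] .
    have split: "(A - \<Phi>) *\<^sub>v z = A *\<^sub>v z - \<Phi> *\<^sub>v z" by (rule minus_mult_distrib_mat_vec[OF A \<Phi> z])
    have D: "l2_norm ((A - \<Phi>) *\<^sub>v z) \<le> q * E * l2_norm z"
      using spectral_norm_cols_bound[OF A\<Phi> z sp] mult_right_mono[OF pert l2_norm_nonneg[of z]] by linarith
    have "\<Phi> *\<^sub>v z = A *\<^sub>v z - (A - \<Phi>) *\<^sub>v z"
      unfolding split using Az \<Phi>z by (simp add: minus_diff_vec_cancel)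
    then have "l2_norm (\<Phi> *\<^sub>v z) \<le> q * (1 + E) * l2_norm z"
      using l2_norm_diff_triangle[OF Az Dz] D rip_upper[OF A rip z sp] by (simp add: q_def algebra_simps)
    then have "(l2_norm (\<Phi> *\<^sub>v z))\<^sup>2 \<le> (q * (1 + E) * l2_norm z)\<^sup>2" by (rule power_mono) simp
    also have "\<dots> \<le> 1.1 * (l2_norm z)\<^sup>2"
      unfolding power_mult_distrib[of _ "l2_norm z"] using qE by (rule mult_right_mono) simp
    finally show "(l2_norm (\<Phi> *\<^sub>v z))\<^sup>2 \<le> (1 + 1 / 10) * (l2_norm z)\<^sup>2" by simp
    have "A *\<^sub>v z = \<Phi> *\<^sub>v z + (A - \<Phi>) *\<^sub>v z"
      unfolding split using Az \<Phi>z by (simp add: add_diff_vec_cancel)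
    then have "(p - q * E) * l2_norm z \<le> l2_norm (\<Phi> *\<^sub>v z)"
      using l2_norm_triangle[OF \<Phi>z Dz] D rip_lower[OF A rip z sp] by (simp add: p_def algebra_simps)
    then have "((p - q * E) * l2_norm z)\<^sup>2 \<le> (l2_norm (\<Phi> *\<^sub>v z))\<^sup>2"
      using diff0 by (intro power_mono) auto
    moreover have "0.9 * (l2_norm z)\<^sup>2 \<le> ((p - q * E) * l2_norm z)\<^sup>2"
      unfolding power_mult_distrib using diff by (rule mult_right_mono) simp
    ultimately show "(1 - 1 / 10) * (l2_norm z)\<^sup>2 \<le> (l2_norm (\<Phi> *\<^sub>v z))\<^sup>2" by simp
  qed
qed

lemma ric_le_of_perturbation:
  assumes "ric A n \<le> 1.1 / (1 + rel_perturbation A \<Phi> n)\<^sup>2 - 1"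
  shows "ric A n \<le> 0.1"
proof -
  have "0 \<le> rel_perturbation A \<Phi> n"
    unfolding rel_perturbation_def by (intro divide_nonneg_nonneg spectral_norm_cols_nonneg)
  then have "1.1 / (1 + rel_perturbation A \<Phi> n)\<^sup>2 \<le> 1.1" by (simp add: divide_le_eq)
  then show ?thesis using assms by simp
qed

text \<open>Keeps the denominators of \<open>alpha_ratio\<close> and \<open>beta_ratio\<close>
  positive: the kept set is nonempty and dominates any nonzero entry left out.\<close>

lemma largest_part_nonzero:
  assumes "largest_part s x xs" "x \<in> carrier_vec d" "x \<noteq> 0\<^sub>v d" "0 < s"
  shows "0 < l2_norm xs"
proof -
  obtain S where S: "S \<subseteq> {..<d}" "card S = min s d"
      "\<forall>i\<in>S. \<forall>j\<in>{..<d} - S. cmod (x $ j) \<le> cmod (x $ i)" "xs = vmask S x"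
    using largest_partE[OF assms(1,2)] .
  obtain j where j: "j < d" "x $ j \<noteq> 0"
    using assms(2,3) by (metis carrier_vecD eq_vecI index_zero_vec)
  have "S \<noteq> {}" using S(2) j(1) \<open>0 < s\<close> by auto
  then obtain i where i: "i \<in> S" "x $ i \<noteq> 0"
  proof (cases "j \<in> S")
    case False
    then obtain i where "i \<in> S" using \<open>S \<noteq> {}\<close> by blast
    then have "cmod (x $ j) \<le> cmod (x $ i)" using S(3) False j(1) by blast
    then have "x $ i \<noteq> 0" using j(2) by auto
    then show ?thesis using that \<open>i \<in> S\<close> by blast
  qed (use j that in blast)
  have "cmod (xs $ i) \<le> l2_norm xs" using i(1) S(1,4) assms(2) by (intro cmod_le_l2_norm) auto
  moreover have "cmod (xs $ i) > 0" using i S(1,4) assms(2) by auto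
  ultimately show ?thesis by linarith
qed

section \<open>Recovery with a perturbed decoding matrix\<close>

text \<open>The compressibility condition says that the energy bound for the tail
  \<open>x - xs\<close> is at most half the isometry lower bound for \<open>xs\<close>; so the tail
  can cancel at most half of that bound.\<close>

lemma measurement_lower_bound:
  assumes A: "A \<in> carrier_mat m d" and s: "0 < s" and d: "0 < d" and ric: "ric A s \<le> 0.1"
    and x: "x \<in> carrier_vec d" and xs: "xs \<in> carrier_vec d" "sparse s xs" "0 < l2_norm xs"
    and compressible: "alpha_ratio x xs + beta_ratio s x xs \<le> 1 / (2 * kappa A s)"
  shows "l2_norm xs \<le> 2.2 * l2_norm (A *\<^sub>v x)"
proof -
  define p where "p = sqrt (1 - ric A s)"
  define q where "q = sqrt (1 + ric A s)"
  define U where "U = l2_norm (x - xs) + l1_norm (x - xs) / sqrt (real s)"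
  have rip: "rip A s (ric A s)" by (rule rip_ric[OF A d s])
  have r0: "0 \<le> ric A s" by (rule rip_nonneg[OF A rip d s])
  \<comment> \<open>Its square is below 0.9, and 2 divided by 10/11 is the constant 2.2.\<close>
  have p: "10 / 11 \<le> p" unfolding p_def using ric by (intro real_le_rsqrt) (simp add: power2_eq_square)
  have q: "1 \<le> q" unfolding q_def using r0 by simp
  have "U / l2_norm xs \<le> p / (2 * q)"
    using compressible by (simp add: U_def p_def q_def alpha_ratio_def beta_ratio_def kappa_def add_divide_distrib)
  then have "q * U \<le> p * l2_norm xs / 2"
    using xs(3) q by (simp add: field_simps)
  moreover have "l2_norm (A *\<^sub>v (x - xs)) \<le> q * U"
    unfolding q_def U_def using x xs by (intro energy_bound[OF A rip s r0]) simp
  moreover have "p * l2_norm xs \<le> l2_norm (A *\<^sub>v xs)"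
    unfolding p_def by (rule rip_lower[OF A rip xs(1,2)])
  moreover have "l2_norm (A *\<^sub>v xs) \<le> l2_norm (A *\<^sub>v x) + l2_norm (A *\<^sub>v (x - xs))"
  proof -
    have Ax: "A *\<^sub>v x \<in> carrier_vec m" and Axs: "A *\<^sub>v xs \<in> carrier_vec m" using A x xs by simp_all
    have "A *\<^sub>v (x - xs) = A *\<^sub>v x - A *\<^sub>v xs" by (rule mult_minus_distrib_mat_vec[OF A x xs(1)])
    then have "A *\<^sub>v xs = A *\<^sub>v x - A *\<^sub>v (x - xs)"
      using minus_diff_vec_cancel[OF Ax Axs] by simp
    moreover have "A *\<^sub>v (x - xs) \<in> carrier_vec m" using A x xs by simp
    ultimately show ?thesis using l2_norm_diff_triangle[OF Ax] by simp
  qed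
  ultimately have "p * l2_norm xs \<le> 2 * l2_norm (A *\<^sub>v x)" by linarith
  moreover have "10 / 11 * l2_norm xs \<le> p * l2_norm xs" using p by (rule mult_right_mono) simp
  ultimately show ?thesis by simp
qed

text \<open>The tail \<open>x - xs\<close> is not sparse and pays the full spectral norm, weighted
  by \<open>alpha_ratio\<close>; the sparse head pays only the norm over s columns.\<close>

lemma perturbation_error:
  assumes \<Phi>: "\<Phi> \<in> carrier_mat m d"
    and x: "x \<in> carrier_vec d" and xs: "xs \<in> carrier_vec d" "sparse s xs" "0 < l2_norm xs"
  shows "l2_norm ((A - \<Phi>) *\<^sub>v x)
    \<le> (spectral_norm (A - \<Phi>) * alpha_ratio x xs + spectral_norm_cols s (A - \<Phi>)) * l2_norm xs"
proof -
  let ?D = "A - \<Phi>"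
  have D: "?D \<in> carrier_mat m d" using \<Phi> by (rule minus_carrier_mat)
  have u: "x - xs \<in> carrier_vec d" using x xs by simp
  have Dxs: "?D *\<^sub>v xs \<in> carrier_vec m" and Du: "?D *\<^sub>v (x - xs) \<in> carrier_vec m"
    using mult_mat_vec_carrier[OF D] xs u by blast+
  have "x = (x - xs) + xs" using x xs by auto
  then have "?D *\<^sub>v x = ?D *\<^sub>v (x - xs) + ?D *\<^sub>v xs"
    using mult_add_distrib_mat_vec[OF D u xs(1)] by simp
  then have "l2_norm (?D *\<^sub>v x) \<le> l2_norm (?D *\<^sub>v (x - xs)) + l2_norm (?D *\<^sub>v xs)"
    using l2_norm_triangle[OF Du Dxs] by simp
  also have "\<dots> \<le> spectral_norm ?D * l2_norm (x - xs) + spectral_norm_cols s ?D * l2_norm xs"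
    using spectral_norm_bound[OF D u] spectral_norm_cols_bound[OF D xs(1,2)] by linarith
  also have "l2_norm (x - xs) = alpha_ratio x xs * l2_norm xs"
    using xs(3) by (simp add: alpha_ratio_def)
  finally show ?thesis by (simp add: algebra_simps)
qed

theorem theorem2p2:
  shows "\<exists>C::real. C > 0 \<and>
    (\<forall>(s::nat) (m::nat) (d::nat) (A::complex mat) (\<Phi>::complex mat)
        (x::complex vec) (xs::complex vec) (b::complex vec) (e::complex vec) (y::complex vec)
        (a::nat \<Rightarrow> complex vec).
      s \<ge> 1 \<longrightarrow>
      A \<in> carrier_mat m d \<longrightarrow> \<Phi> \<in> carrier_mat m d \<longrightarrow>
      ric A (4 * s) \<le> 1.1 / (1 + rel_perturbation A \<Phi> (4 * s))\<^sup>2 - 1 \<longrightarrow>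
      x \<in> carrier_vec d \<longrightarrow> x \<noteq> 0\<^sub>v d \<longrightarrow>
      b = A *\<^sub>v x \<longrightarrow>
      e \<in> carrier_vec m \<longrightarrow>
      y = A *\<^sub>v x + e \<longrightarrow>
      largest_part s x xs \<longrightarrow>
      alpha_ratio x xs + beta_ratio s x xs \<le> 1 / (2 * kappa A s) \<longrightarrow>
      cosamp_run \<Phi> y s a \<longrightarrow>
      (\<exists>K. \<forall>k \<ge> K.
        l2_norm (a k - x) \<le>
          C * (l2_norm (x - xs) + 1 / sqrt (real s) * l1_norm (x - xs)
               + (spectral_norm (A - \<Phi>) * alpha_ratio x xs + spectral_norm_cols s (A - \<Phi>))
                   * l2_norm b
               + l2_norm e)))"
proof (intro exI[of _ "33::real"] conjI allI impI)
  fix s m d :: nat and A \<Phi> :: "complex mat" and x xs b e y :: "complex vec"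
    and a :: "nat \<Rightarrow> complex vec"
  assume s1: "s \<ge> 1" and A: "A \<in> carrier_mat m d" and \<Phi>: "\<Phi> \<in> carrier_mat m d"
    and ric: "ric A (4 * s) \<le> 1.1 / (1 + rel_perturbation A \<Phi> (4 * s))\<^sup>2 - 1"
    and x: "x \<in> carrier_vec d" "x \<noteq> 0\<^sub>v d" and b: "b = A *\<^sub>v x" and e: "e \<in> carrier_vec m"
    and y: "y = A *\<^sub>v x + e" and lp: "largest_part s x xs"
    and compressible: "alpha_ratio x xs + beta_ratio s x xs \<le> 1 / (2 * kappa A s)"
    and run: "cosamp_run \<Phi> y s a"
  define \<eta> where "\<eta> = spectral_norm (A - \<Phi>) * alpha_ratio x xs + spectral_norm_cols s (A - \<Phi>)"
  define U where "U = l2_norm (x - xs) + 1 / sqrt (real s) * l1_norm (x - xs)"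
  define \<nu> where "\<nu> = U + \<eta> * l2_norm b + l2_norm e"
  have s: "0 < s" "0 < 4 * s" using s1 by auto
  have d: "0 < d" using x by (cases d) auto
  have xs: "xs \<in> carrier_vec d" "sparse s xs" "0 < l2_norm xs"
    using largest_part_carrier[OF lp x(1)] largest_part_sparse[OF lp x(1)]
      largest_part_nonzero[OF lp x s(1)] by auto
  have rip: "rip \<Phi> (4 * s) (1 / 10)" by (rule rip_perturbed[OF A \<Phi> d s(2) ric])
  \<comment> \<open>Smallness is assumed at order 4s, whereas \<open>kappa\<close> involves order
    s.\<close>
  have "ric A s \<le> ric A (4 * s)"
    by (rule ric_le[OF A d s(1) rip_mono[OF rip_ric[OF A d s(2)]]]) simp
  then have ric_s: "ric A s \<le> 0.1" using ric_le_of_perturbation[OF ric] by simp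
  have signal: "l2_norm xs \<le> 2.2 * l2_norm b"
    unfolding b by (rule measurement_lower_bound[OF A s(1) d ric_s x(1) xs compressible])
  have \<eta>0: "0 \<le> \<eta>"
    unfolding \<eta>_def alpha_ratio_def
    by (intro add_nonneg_nonneg mult_nonneg_nonneg divide_nonneg_nonneg spectral_norm_nonneg
        spectral_norm_cols_nonneg) auto
  have U0: "0 \<le> U" and xU: "l2_norm (x - xs) \<le> U" unfolding U_def by auto
  have "l2_norm ((A - \<Phi>) *\<^sub>v x) \<le> \<eta> * l2_norm xs"
    unfolding \<eta>_def by (rule perturbation_error[OF \<Phi> x(1) xs])
  also have "\<dots> \<le> \<eta> * (2.2 * l2_norm b)" using signal \<eta>0 by (rule mult_left_mono)
  finally have pert: "l2_norm ((A - \<Phi>) *\<^sub>v x) \<le> 2.2 * (\<eta> * l2_norm b)" by simp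
  \<comment> \<open>The tail is not sparse, so the energy bound for \<open>\<Phi>\<close> takes the
    place of the isometry property.\<close>
  have "l2_norm (\<Phi> *\<^sub>v (x - xs)) \<le> sqrt (1 + 1 / 10) * U"
    unfolding U_def using energy_bound[OF \<Phi> rip_mono[OF rip, of s] s(1), of "x - xs"] x xs by simp
  also have "\<dots> \<le> 21 / 20 * U" using sqrt_11_10 U0 by (rule mult_right_mono)
  finally have tail: "l2_norm (\<Phi> *\<^sub>v (x - xs)) \<le> 21 / 20 * U" .
  define e' where "e' = (A - \<Phi>) *\<^sub>v x + \<Phi> *\<^sub>v (x - xs) + e"
  have D: "A - \<Phi> \<in> carrier_mat m d" using \<Phi> by (rule minus_carrier_mat)
  have carr: "A *\<^sub>v x \<in> carrier_vec m" "\<Phi> *\<^sub>v x \<in> carrier_vec m" "\<Phi> *\<^sub>v xs \<in> carrier_vec m"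
    "(A - \<Phi>) *\<^sub>v x \<in> carrier_vec m" "\<Phi> *\<^sub>v (x - xs) \<in> carrier_vec m"
    using mult_mat_vec_carrier[OF A] mult_mat_vec_carrier[OF \<Phi>] mult_mat_vec_carrier[OF D] x xs by auto
  have e': "e' \<in> carrier_vec m" using carr e by (simp add: e'_def)
  have "l2_norm e' \<le> l2_norm ((A - \<Phi>) *\<^sub>v x) + l2_norm (\<Phi> *\<^sub>v (x - xs)) + l2_norm e"
    using l2_norm_triangle[of "(A - \<Phi>) *\<^sub>v x + \<Phi> *\<^sub>v (x - xs)" m e]
      l2_norm_triangle[OF carr(4,5)] carr e unfolding e'_def by simp
  moreover have "0 \<le> \<eta> * l2_norm b" using \<eta>0 by simp
  \<comment> \<open>The largest of the coefficients 2.2, 21/20 and 1 of the three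
    contributions.\<close>
  ultimately have noise: "l2_norm e' \<le> 2.2 * \<nu>"
    using pert tail U0 l2_norm_nonneg[of e] unfolding \<nu>_def by (simp only: ring_distribs)
  have \<nu>0: "0 \<le> \<nu>" using U0 \<open>0 \<le> \<eta> * l2_norm b\<close> by (simp add: \<nu>_def)
  have "y = \<Phi> *\<^sub>v xs + e'"
    unfolding y e'_def minus_mult_distrib_mat_vec[OF A \<Phi> x(1)] mult_minus_distrib_mat_vec[OF \<Phi> x(1) xs(1)]
    by (rule measurement_split[OF carr(1-3) e])
  then have run': "cosamp_run \<Phi> (\<Phi> *\<^sub>v xs + e') s a" using run by simp
  have dist: "l2_norm (a k - x) \<le> l2_norm (xs - a k) + U" for k
  proof -
    have ak: "a k \<in> carrier_vec d" by (rule cosamp_run_step(1)[OF \<Phi> rip xs(1,2) e' run'])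
    show ?thesis
      using l2_norm_triangle_mid[OF ak xs(1) x(1)] l2_norm_minus_commute[OF ak xs(1)]
        l2_norm_minus_commute[OF xs(1) x(1)] xU by simp
  qed
  have U\<nu>: "U \<le> \<nu>" using \<open>0 \<le> \<eta> * l2_norm b\<close> by (simp add: \<nu>_def)
  \<comment> \<open>Origin of 33: the noise contributes 14 * 2.2 = 30.8, while the decaying term and
    \<open>U\<close> add at most one \<open>\<nu>\<close> each. For the decaying term this takes a
    positive \<open>\<nu>\<close>.\<close>
  have "\<exists>K. \<forall>k\<ge>K. l2_norm (a k - x) \<le> 33 * \<nu>"
  proof (cases "\<nu> = 0")
    case True
    then have "l2_norm e' = 0" using noise l2_norm_nonneg[of e'] by simp
    then obtain K where K: "\<forall>k\<ge>K. a k = xs"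
      using cosamp_exact_recovery[OF \<Phi> rip xs(1,2) e' _ run'] by blast
    have "l2_norm (a k - x) \<le> 33 * \<nu>" if "k \<ge> K" for k
    proof -
      have "l2_norm (xs - a k) = 0" using K that xs(1) by simp
      then show ?thesis using dist[of k] U\<nu> True by linarith
    qed
    then show ?thesis by blast
  next
    case False
    then obtain K where K: "\<And>k. k \<ge> K \<Longrightarrow> (1 / 2) ^ k * l2_norm xs < \<nu>"
      using half_power_eventually_less[of \<nu> "l2_norm xs"] \<nu>0 by auto
    have "l2_norm (a k - x) \<le> 33 * \<nu>" if "k \<ge> K" for k
      using cosamp_error[OF \<Phi> rip xs(1,2) e' run', of k] K[OF that] noise dist[of k] U\<nu> \<nu>0 by linarith
    then show ?thesis by blast
  qed
  then show "\<exists>K. \<forall>k \<ge> K.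
        l2_norm (a k - x) \<le>
          33 * (l2_norm (x - xs) + 1 / sqrt (real s) * l1_norm (x - xs)
               + (spectral_norm (A - \<Phi>) * alpha_ratio x xs + spectral_norm_cols s (A - \<Phi>))
                   * l2_norm b
               + l2_norm e)"
    unfolding \<nu>_def U_def \<eta>_def .
qed simp

end
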